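(* Let $$c_1=0,\quad c_2=\tfrac1{10}(5-\sqrt5),\quad c_3=\tfrac1{10}(5+\sqrt5),\quad \chi=\tfrac1{30}(3-\sqrt5),$$ $$\beta=\tfrac1{60}(1+\sqrt5),\quad \delta=\tfrac1{60}(5+3\sqrt5),\quad \eta=\tfrac1{24}(5+\sqrt5).$$ Then the 3-stage modified two-derivative diagonally implicit Runge--Kutta method with nodes $c_1,c_2,c_3$ and coefficients $a_{21}(\mu)=\chi$, $a_{31}(\mu)=\beta$, $a_{32}(\mu)=\delta$, $b_2(\mu)=\eta$, $$a_{11}(\mu)=\frac1{\mu^2}\left(1-\frac{2}{E_\mu^{+}(c_1)}\right),\qquad a_{22}(\mu)=\frac{E_\mu^{+}(c_2)-\left(2+\chi\mu^2E_\mu^{+}(c_1)\right)}{\mu^2E_\mu^{+}(c_2)},$$ $$a_{33}(\mu)=\frac{E_\mu^{+}(c_3)-\mu^2\left(\beta E_\mu^{+}(c_1)+\delta E_\mu^{+}(c_2)\right)-2}{\mu^2E_\mu^{+}(c_3)},\qquad \xi_1(\mu)=\frac{E_\mu^{-}(c_1)}{c_1\mu E_\mu^{+}(c_1)},$$ $$\xi_2(\mu)=\frac{E_\mu^{-}(c_2)-\chi\mu^2E_\mu^{-}(c_1-c_2)}{c_2\mu E_\mu^{+}(c_2)},\qquad \xi_3(\mu)=\frac{E_\mu^{-}(c_3)-\mu^2\left(\beta E_\mu^{-}(c_1-c_3)+\delta E_\mu^{-}(c_2-c_3)\right)}{c_3\mu E_\mu^{+}(c_3)},$$ $$b_1(\mu)=\frac{E_\mu^{-}(c_3)+E_\mu^{-}(1-c_3)-\mu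 E_\mu^{+}(c_3)-\eta\mu^2E_\mu^{-}(c_2-c_3)}{\mu^2E_\mu^{-}(c_1-c_3)},$$ $$b_3(\mu)=\frac{\mu E_\mu^{+}(c_1)-E_\mu^{-}(c_1)-E_\mu^{-}(1-c_1)-\eta\mu^2E_\mu^{-}(c_1-c_2)}{\mu^2E_\mu^{-}(c_1-c_3)}$$ is exponentially fitted (it satisfies the fitting conditions for $e^{\pm\mathrm{i}\omega x}$) and has order of consistency six.
   Context: A 3-stage modified two-derivative diagonally implicit Runge--Kutta (TDDIRK) method for $y'=f(y)$, with $g(y)=f'(y)f(y)$, stepsize $h$, frequency $\omega>0$ and $\mu=\mathrm{i}\omega h$, is $$Y_i = y_n+\xi_i(\mu)c_{i} h f(y_n)+h^2\sum_{j=1}^{i} a_{ij}(\mu)g(Y_j),\ i=1,2,3,\qquad y_{n+1} = y_n+h f(y_n)+h^2\sum_{i=1}^3 b_i(\mu)g(Y_i).$$ $E_\mu^{+}(\zeta)=e^{\zeta\mu}+e^{-\zeta\mu}$, $E_\mu^{-}(\zeta)=e^{\zeta\mu}-e^{-\zeta\mu}$ for $\zeta\in\mathbb{R}$. Removable singularities are filled by limits: at $\mu=0$, and in $\xi_1$, where $c_1=0$ gives $\xi_1=1$ (also $a_{11}=0$); $h$ is small enough that the denominators do not vanish. Fitting conditions for $e^{\pm\mathrm{i}\omega x}$ (degree $(0,1)$), for both choices of sign: $$\mu^2\sum_{j=1}^{i}a_{ij}(\mu)e^{\pm c_j\mu}\pm\xi_i(\mu)c_i\mu=e^{\pm c_i\mu}-1\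 (i=1,2,3),\qquad \mu^2\sum_{i=1}^{3}b_i(\mu)e^{\pm c_i\mu}=e^{\pm\mu}-1\mp\mu.$$ Order of consistency $p$: for $f$ sufficiently smooth and $y(x_n)=y_n$, $y(x_n+h)-y_{n+1}=\mathcal{O}(h^{p+1})$ as $h\to0$ (with $\omega$ fixed). *)

theory Defs
  imports "HOL-Complex_Analysis.Complex_Analysis" "HOL-Library.Landau_Symbols"
begin

text \<open>
  Maps of class \<open>C^k\<close> on an open set \<open>U\<close>. The differential is tested on fixed vectors
  \<open>v\<close>; in finite dimension this agrees with continuity in the operator norm.
\<close>

primrec C_k_on :: "nat \<Rightarrow> ('a::real_normed_vector \<Rightarrow> 'b::real_normed_vector) \<Rightarrow> 'a set \<Rightarrow> bool" where
  "C_k_on 0 f U \<longleftrightarrow> continuous_on U f"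
| "C_k_on (Suc k) f U \<longleftrightarrow>
     (\<forall>x\<in>U. f differentiable (at x)) \<and> (\<forall>v. C_k_on k (\<lambda>x. frechet_derivative f (at x) v) U)"

section \<open>Modified TDDIRK methods\<close>

text \<open>
  Stages are numbered 1, 2, 3; values of the components at other indices are never used,
  nor are those of \<open>acoef\<close> above the diagonal.
\<close>

record mtddirk =
  node :: "nat \<Rightarrow> real"
  xi :: "nat \<Rightarrow> complex \<Rightarrow> complex"
  acoef :: "nat \<Rightarrow> nat \<Rightarrow> complex \<Rightarrow> complex"
  bcoef :: "nat \<Rightarrow> complex \<Rightarrow> complex"

definition gder :: "('a::real_normed_vector \<Rightarrow> 'a) \<Rightarrow> 'a \<Rightarrow> 'a" where
  "gder f y = frechet_derivative f (at y) (f y)"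

text \<open>
  The phase space is real, so the coefficients act through their real parts. For the method
  below they are real at \<open>\<mu> = \<i>\<omega>h\<close>; see lemma \<open>ef_method_real\<close>.
\<close>

definition stage_eqs ::
  "mtddirk \<Rightarrow> real \<Rightarrow> ('a::real_normed_vector \<Rightarrow> 'a) \<Rightarrow> 'a \<Rightarrow> real \<Rightarrow> (nat \<Rightarrow> 'a) \<Rightarrow> bool" where
  "stage_eqs M \<omega> f y\<^sub>n h Y \<longleftrightarrow> (let \<mu> = \<i> * of_real (\<omega> * h) in
     \<forall>i\<in>{1..3}. Y i = y\<^sub>n + (Re (xi M i \<mu>) * node M i * h) *\<^sub>R f y\<^sub>n
                        + h\<^sup>2 *\<^sub>R (\<Sum>j=1..i. Re (acoef M i j \<mu>) *\<^sub>R gder f (Y j)))"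

definition step ::
  "mtddirk \<Rightarrow> real \<Rightarrow> ('a::real_normed_vector \<Rightarrow> 'a) \<Rightarrow> 'a \<Rightarrow> real \<Rightarrow> (nat \<Rightarrow> 'a) \<Rightarrow> 'a" where
  "step M \<omega> f y\<^sub>n h Y = (let \<mu> = \<i> * of_real (\<omega> * h) in
     y\<^sub>n + h *\<^sub>R f y\<^sub>n + h\<^sup>2 *\<^sub>R (\<Sum>i=1..3. Re (bcoef M i \<mu>) *\<^sub>R gder f (Y i)))"

text \<open>
  The stage equations are implicit and may have spurious solutions far from \<open>y\<^sub>n\<close>;
  the numerical solution is the branch emanating from \<open>y\<^sub>n\<close>.
\<close>

definition stage_branch ::
  "mtddirk \<Rightarrow> real \<Rightarrow> ('a::real_normed_vector \<Rightarrow> 'a) \<Rightarrow> 'a \<Rightarrow> (real \<Rightarrow> nat \<Rightarrow> 'a) \<Rightarrow> bool" where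
  "stage_branch M \<omega> f y\<^sub>n Y \<longleftrightarrow>
     (\<forall>\<^sub>F h in at_right 0. stage_eqs M \<omega> f y\<^sub>n h (Y h)) \<and>
     (\<forall>i\<in>{1..3}. ((\<lambda>h. Y h i) \<longlongrightarrow> y\<^sub>n) (at_right 0))"

text \<open>
  Order of consistency (at least) \<open>p\<close> at frequency \<open>\<omega>\<close>. The degree of smoothness \<open>k\<close>
  required of \<open>f\<close> may not depend on the problem. Existence of a branch is demanded, so that
  the error bound is not vacuous.
\<close>

definition consistency_order ::
  "'a::euclidean_space itself \<Rightarrow> mtddirk \<Rightarrow> real \<Rightarrow> nat \<Rightarrow> bool" where
  "consistency_order _ M \<omega> p \<longleftrightarrow>
     (\<exists>k. \<forall>(U::'a set) f y x\<^sub>n T.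
        open U \<and> C_k_on k f U \<and> T > 0 \<and>
        (\<forall>x\<in>{x\<^sub>n..x\<^sub>n + T}. y x \<in> U \<and>
           (y has_vector_derivative f (y x)) (at x within {x\<^sub>n..x\<^sub>n + T})) \<longrightarrow>
        (\<exists>Y. stage_branch M \<omega> f (y x\<^sub>n) Y) \<and>
        (\<forall>Y. stage_branch M \<omega> f (y x\<^sub>n) Y \<longrightarrow>
           (\<lambda>h. norm (y (x\<^sub>n + h) - step M \<omega> f (y x\<^sub>n) h (Y h))) \<in> O[at_right 0](\<lambda>h. h ^ (p + 1))))"

definition exp_fitted_at :: "mtddirk \<Rightarrow> complex \<Rightarrow> bool" where
  "exp_fitted_at M \<mu> \<longleftrightarrow> (\<forall>s\<in>{1, -1}.
     (\<forall>i\<in>{1..3}. \<mu>\<^sup>2 * (\<Sum>j=1..i. acoef M i j \<mu> * exp (s * of_real (node M j) * \<mu>))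
                   + s * xi M i \<mu> * of_real (node M i) * \<mu>
                 = exp (s * of_real (node M i) * \<mu>) - 1) \<and>
     \<mu>\<^sup>2 * (\<Sum>i=1..3. bcoef M i \<mu> * exp (s * of_real (node M i) * \<mu>)) = exp (s * \<mu>) - 1 - s * \<mu>)"

section \<open>The method\<close>

definition Ep :: "complex \<Rightarrow> real \<Rightarrow> complex" where
  "Ep \<mu> \<zeta> = exp (of_real \<zeta> * \<mu>) + exp (- of_real \<zeta> * \<mu>)"

definition Em :: "complex \<Rightarrow> real \<Rightarrow> complex" where
  "Em \<mu> \<zeta> = exp (of_real \<zeta> * \<mu>) - exp (- of_real \<zeta> * \<mu>)"

definition c1 :: real where "c1 = 0"
definition c2 :: real where "c2 = (5 - sqrt 5) / 10"
definition c3 :: real where "c3 = (5 + sqrt 5) / 10"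
definition chi :: real where "chi = (3 - sqrt 5) / 30"
definition beta :: real where "beta = (1 + sqrt 5) / 60"
definition delta :: real where "delta = (5 + 3 * sqrt 5) / 60"
definition eta :: real where "eta = (5 + sqrt 5) / 24"

definition a11 :: "complex \<Rightarrow> complex" where
  "a11 = remove_sings (\<lambda>\<mu>. 1 / \<mu>\<^sup>2 * (1 - 2 / Ep \<mu> c1))"

definition a22 :: "complex \<Rightarrow> complex" where
  "a22 = remove_sings (\<lambda>\<mu>. (Ep \<mu> c2 - (2 + of_real chi * \<mu>\<^sup>2 * Ep \<mu> c1)) / (\<mu>\<^sup>2 * Ep \<mu> c2))"

definition a33 :: "complex \<Rightarrow> complex" where
  "a33 = remove_sings (\<lambda>\<mu>.
     (Ep \<mu> c3 - \<mu>\<^sup>2 * (of_real beta * Ep \<mu> c1 + of_real delta * Ep \<mu> c2) - 2) / (\<mu>\<^sup>2 * Ep \<mu> c3))"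

text \<open>
  Since \<open>c1 = 0\<close>, the formula for \<open>\<xi>\<^sub>1\<close> is also singular in the node, and is filled by the
  limit in both variables; the result is the constant 1 (lemma \<open>xi1_eq\<close>).
\<close>

definition xi1 :: "complex \<Rightarrow> complex" where
  "xi1 = remove_sings (\<lambda>\<mu>. Lim (at c1) (\<lambda>c. Em \<mu> c / (of_real c * \<mu> * Ep \<mu> c)))"

definition xi2 :: "complex \<Rightarrow> complex" where
  "xi2 = remove_sings (\<lambda>\<mu>.
     (Em \<mu> c2 - of_real chi * \<mu>\<^sup>2 * Em \<mu> (c1 - c2)) / (of_real c2 * \<mu> * Ep \<mu> c2))"

definition xi3 :: "complex \<Rightarrow> complex" where
  "xi3 = remove_sings (\<lambda>\<mu>.
     (Em \<mu> c3 - \<mu>\<^sup>2 * (of_real beta * Em \<mu> (c1 - c3) + of_real delta * Em \<mu> (c2 - c3)))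
       / (of_real c3 * \<mu> * Ep \<mu> c3))"

definition b1 :: "complex \<Rightarrow> complex" where
  "b1 = remove_sings (\<lambda>\<mu>.
     (Em \<mu> c3 + Em \<mu> (1 - c3) - \<mu> * Ep \<mu> c3 - of_real eta * \<mu>\<^sup>2 * Em \<mu> (c2 - c3))
       / (\<mu>\<^sup>2 * Em \<mu> (c1 - c3)))"

definition b3 :: "complex \<Rightarrow> complex" where
  "b3 = remove_sings (\<lambda>\<mu>.
     (\<mu> * Ep \<mu> c1 - Em \<mu> c1 - Em \<mu> (1 - c1) - of_real eta * \<mu>\<^sup>2 * Em \<mu> (c1 - c2))
       / (\<mu>\<^sup>2 * Em \<mu> (c1 - c3)))"

definition ef_method :: mtddirk where
  "ef_method =
     \<lparr> node = (\<lambda>_. 0)(1 := c1, 2 := c2, 3 := c3),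
       xi = (\<lambda>_ _. 0)(1 := xi1, 2 := xi2, 3 := xi3),
       acoef = (\<lambda>_ _ _. 0)
         (1 := (\<lambda>_ _. 0)(1 := a11),
          2 := (\<lambda>_ _. 0)(1 := \<lambda>_. of_real chi, 2 := a22),
          3 := (\<lambda>_ _. 0)(1 := \<lambda>_. of_real beta, 2 := \<lambda>_. of_real delta, 3 := a33)),
       bcoef = (\<lambda>_ _. 0)(1 := b1, 2 := \<lambda>_. of_real eta, 3 := b3) \<rparr>"

definition denominators_nonzero :: "complex \<Rightarrow> bool" where
  "denominators_nonzero \<mu> \<longleftrightarrow>
     Ep \<mu> c1 \<noteq> 0 \<and> Ep \<mu> c2 \<noteq> 0 \<and> Ep \<mu> c3 \<noteq> 0 \<and> Em \<mu> (c1 - c3) \<noteq> 0"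

section \<open>Sanity checks\<close>

lemma a11_eq: "a11 \<mu> = 0"
proof -
  have "(\<lambda>\<mu>. 1 / \<mu>\<^sup>2 * (1 - 2 / Ep \<mu> c1)) = (\<lambda>_. 0)"
    by (simp add: Ep_def c1_def)
  then show ?thesis
    unfolding a11_def by (auto intro!: remove_sings_eqI)
qed

lemma xi1_eq: "xi1 \<mu> = 1"
proof -
  have lim: "Lim (at c1) (\<lambda>c. Em z c / (of_real c * z * Ep z c)) = 1" if "z \<noteq> 0" for z
  proof (rule tendsto_Lim)
    have "((\<lambda>w. exp (w * z) - exp (- w * z)) has_field_derivative 2 * z) (at 0)"
      by (auto intro!: derivative_eq_intros)
    then have "((\<lambda>w. (exp (w * z) - exp (- w * z)) / w) \<longlongrightarrow> 2 * z) (at 0)"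
      by (simp add: DERIV_def)
    moreover have "filterlim complex_of_real (at 0) (at 0)"
      by (intro filterlim_atI) (auto intro!: tendsto_eq_intros simp: eventually_at_filter)
    ultimately have "((\<lambda>c. Em z c / of_real c) \<longlongrightarrow> 2 * z) (at 0)"
      unfolding Em_def by (rule filterlim_compose)
    moreover have "((\<lambda>c. Ep z c) \<longlongrightarrow> 2) (at 0)"
      unfolding Ep_def by (auto intro!: tendsto_eq_intros)
    ultimately have "((\<lambda>c. (Em z c / of_real c) / (z * Ep z c)) \<longlongrightarrow> 2 * z / (z * 2)) (at 0)"
      using that by (intro tendsto_intros) auto
    then show "((\<lambda>c. Em z c / (of_real c * z * Ep z c)) \<longlongrightarrow> 1) (at c1)"
      using that by (simp add: c1_def mult.assoc)
  qed simp
  have "\<forall>\<^sub>F z in at \<mu>. z \<noteq> 0"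
    by (simp add: eventually_neq_at_within)
  then have "((\<lambda>z. Lim (at c1) (\<lambda>c. Em z c / (of_real c * z * Ep z c))) \<longlongrightarrow> 1) (at \<mu>)"
    using lim by (intro tendsto_eventually) (auto elim: eventually_mono)
  then show ?thesis
    unfolding xi1_def by (rule remove_sings_eqI)
qed

lemma remove_sings_real:
  assumes "\<And>t. f (\<i> * of_real t) \<in> \<real>"
  shows "remove_sings f (\<i> * of_real t) \<in> \<real>"
proof (cases "\<exists>c. f \<midarrow>\<i> * of_real t\<rightarrow> c")
  case True
  then obtain c where c: "f \<midarrow>\<i> * of_real t\<rightarrow> c" by blast
  have "filterlim (\<lambda>s::real. \<i> * of_real s) (at (\<i> * of_real t)) (at t)"
    by (intro filterlim_atI) (auto intro!: tendsto_eq_intros simp: eventually_at_filter)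
  from filterlim_compose[OF c this] have "((\<lambda>s::real. f (\<i> * of_real s)) \<longlongrightarrow> c) (at t)" .
  then have "c \<in> \<real>"
    by (rule Lim_in_closed_set[OF closed_complex_Reals, rotated 2]) (use assms in auto)
  then show ?thesis
    using remove_sings_eqI[OF c] by simp
next
  case False
  then show ?thesis by (simp add: remove_sings_def)
qed

lemma Ep_imaginary: "Ep (\<i> * of_real t) \<zeta> = of_real (2 * cos (\<zeta> * t))"
  by (simp add: Ep_def complex_eq_iff Re_exp Im_exp)

lemma Em_imaginary: "Em (\<i> * of_real t) \<zeta> = \<i> * of_real (2 * sin (\<zeta> * t))"
  by (simp add: Em_def complex_eq_iff Re_exp Im_exp)

lemma ef_method_real:
  fixes t :: real
  shows "xi ef_method i (\<i> * of_real t) \<in> \<real>"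
    and "acoef ef_method i j (\<i> * of_real t) \<in> \<real>"
    and "bcoef ef_method i (\<i> * of_real t) \<in> \<real>"
proof -
  have *: "a22 (\<i> * of_real t) \<in> \<real>" "a33 (\<i> * of_real t) \<in> \<real>"
    "xi2 (\<i> * of_real t) \<in> \<real>" "xi3 (\<i> * of_real t) \<in> \<real>"
    "b1 (\<i> * of_real t) \<in> \<real>" "b3 (\<i> * of_real t) \<in> \<real>"
    unfolding a22_def a33_def xi2_def xi3_def b1_def b3_def
    by (rule remove_sings_real,
        simp add: complex_is_Real_iff Ep_imaginary Em_imaginary Im_divide power2_eq_square)+
  show "xi ef_method i (\<i> * of_real t) \<in> \<real>"
    "acoef ef_method i j (\<i> * of_real t) \<in> \<real>"
    "bcoef ef_method i (\<i> * of_real t) \<in> \<real>"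
    using * by (auto simp: ef_method_def a11_eq xi1_eq)
qed

end

theory Submission
  imports Defs
begin

text \<open>
  At $\mu = \mathrm{i}t$ the fitting conditions split into real and imaginary parts, from which
  the coefficients are expanded at $t = 0$: $b_i(\mu) = b_i(0) + O(t^4)$ with
  $\sum_i b_i(\mu) = 1/2 + O(t^5)$, $\xi_i(\mu) = 1 + O(t^4)$ and
  $a_{ii}(\mu) = a_{ii}(0) - K_i t^2 + O(t^4)$, where $K_i = c_i^4/24 - \sum_j a_{ij}(0) c_j^2/2$.
  Since the $b_i(0)$ are the Lobatto weights times $1 - c_i$, the quadrature
  $\int_0^1 (1-s)\varphi(s)\,ds \approx \sum_i b_i \varphi(c_i)$ is exact up to degree 4, so that the
  update formula with the exact values of $y''$ has local error $O(h^7)$. The stages satisfy only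
  $Y_i = y(x_n + c_i h) - h^4 K_i (y^{(4)} + \omega^2 y'') + O(h^5)$, but the vector
  $y^{(4)} + \omega^2 y''$ is the same in all of them and $\sum_i b_i(0) K_i = 0$, so the leading
  stage errors cancel in the update.
\<close>


section \<open>Orders of magnitude of vector-valued functions\<close>

text \<open>Stage errors of size h^4 enter the update with a factor h^2, so a plain estimate stops
  at O(h^6), one power short. The cancellation that gains this power must survive the nonlinear
  \<open>g\<close>: both stage errors are passed through one linear map, the derivative of
  \<open>g\<close> at the initial value, and the remainder of this linearisation is one power of h
  smaller than the errors. The common error vector is forced by the fitting: a stage residual
  vanishes on exp(+-i \<omega> x), so its part K y'''' has to be completed to an expression that
  annihilates these functions, and the shift - K t^2 of the diagonal coefficient supplies K
  \<omega>^2 y''. The vanishing weighted sum of the K is the order-six condition sum b_i a_ij c_j^2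
  = 1/360 at frequency zero. The Lobatto rule is the four-point one with nodes 0, c2, c3, 1 and
  degree 5; the factor 1 - s removes the node 1 and one degree. The sum of the b_i is needed to a
  higher order than each b_i because it multiplies h^2 y'', while the deviation of \<open>b3\<close>
  alone first meets h^3 y'''.\<close>

definition is_Oh :: "nat \<Rightarrow> (real \<Rightarrow> 'a::real_normed_vector) \<Rightarrow> bool" where
  "is_Oh n F \<longleftrightarrow> (\<exists>C. \<forall>\<^sub>F h in at_right 0. norm (F h) \<le> C * h ^ n)"

lemma is_Oh_imp_bigo: "is_Oh n F \<Longrightarrow> (\<lambda>h. norm (F h)) \<in> O[at_right 0](\<lambda>h. h ^ n)"
  unfolding is_Oh_def
proof (elim exE)
  fix C assume "\<forall>\<^sub>F h in at_right 0. norm (F h) \<le> C * h ^ n"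
  then show ?thesis
    using eventually_at_right_less[of "0::real"]
    by (intro bigoI[of _ C]) (auto elim: eventually_elim2)
qed

text \<open>The constant in \<open>is_Oh\<close> carries no sign; as h > 0 it can be enlarged to a
  nonnegative one, which products of bounds require.\<close>

lemma is_Oh_nonneg:
  assumes "is_Oh n F"
  obtains C where "C \<ge> 0" "\<forall>\<^sub>F h in at_right 0. norm (F h) \<le> C * h ^ n"
proof -
  obtain C where C: "\<forall>\<^sub>F h in at_right 0. norm (F h) \<le> C * h ^ n"
    using assms unfolding is_Oh_def by blast
  have "\<forall>\<^sub>F h in at_right 0. norm (F h) \<le> max C 0 * h ^ n"
    using C eventually_at_right_less[of "0::real"]
  proof eventually_elim
    case (elim h)
    have "C * h ^ n \<le> max C 0 * h ^ n"
      using elim(2) by (intro mult_right_mono) auto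
    then show ?case using elim(1) by linarith
  qed
  then show ?thesis by (intro that[of "max C 0"]) auto
qed

lemma is_Oh_cong:
  assumes "is_Oh n F" "\<forall>\<^sub>F h in at_right 0. F h = G h"
  shows "is_Oh n G"
proof -
  obtain C where C: "\<forall>\<^sub>F h in at_right 0. norm (F h) \<le> C * h ^ n"
    using assms unfolding is_Oh_def by blast
  show ?thesis unfolding is_Oh_def
    by (rule exI[of _ C]) (use C assms(2) in \<open>eventually_elim; simp\<close>)
qed

lemma is_Oh_dominated:
  assumes "is_Oh n F" "\<forall>\<^sub>F h in at_right 0. norm (G h) \<le> K * norm (F h)"
  shows "is_Oh n G"
proof -
  obtain C where C: "\<forall>\<^sub>F h in at_right 0. norm (F h) \<le> C * h ^ n"
    using assms unfolding is_Oh_def by blast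
  have "\<forall>\<^sub>F h in at_right 0. norm (G h) \<le> (max K 0 * C) * h ^ n"
    using C assms(2)
  proof eventually_elim
    case (elim h)
    have "norm (G h) \<le> max K 0 * norm (F h)"
      using elim(2) by (meson max.cobounded1 mult_right_mono norm_ge_zero order_trans)
    also have "\<dots> \<le> max K 0 * (C * h ^ n)"
      using elim(1) by (intro mult_left_mono) auto
    finally show ?case by (simp add: mult.assoc)
  qed
  then show ?thesis unfolding is_Oh_def by blast
qed

lemma is_Oh_mono:
  assumes "is_Oh n F" "m \<le> n"
  shows "is_Oh m F"
proof -
  obtain C where C: "C \<ge> 0" "\<forall>\<^sub>F h in at_right 0. norm (F h) \<le> C * h ^ n"
    using assms is_Oh_nonneg by blast
  have "\<forall>\<^sub>F h in at_right (0::real). h < 1"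
    by (rule eventually_at_right_real[of 0 1, THEN eventually_mono]) auto
  then have "\<forall>\<^sub>F h in at_right 0. norm (F h) \<le> C * h ^ m"
    using C(2) eventually_at_right_less[of "0::real"]
  proof eventually_elim
    case (elim h)
    have "h ^ n \<le> h ^ m"
      using elim assms(2) by (intro power_decreasing) auto
    then have "C * h ^ n \<le> C * h ^ m" using C(1) by (rule mult_left_mono)
    then show ?case using elim(2) by linarith
  qed
  then show ?thesis unfolding is_Oh_def by blast
qed

lemma is_Oh_add:
  assumes "is_Oh n F" "is_Oh n G"
  shows "is_Oh n (\<lambda>h. F h + G h)"
proof -
  obtain C D where C: "\<forall>\<^sub>F h in at_right 0. norm (F h) \<le> C * h ^ n"
    and D: "\<forall>\<^sub>F h in at_right 0. norm (G h) \<le> D * h ^ n"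
    using assms unfolding is_Oh_def by blast
  have "\<forall>\<^sub>F h in at_right 0. norm (F h + G h) \<le> (C + D) * h ^ n"
    using C D
  proof eventually_elim
    case (elim h)
    then show ?case
      using norm_triangle_ineq[of "F h" "G h"] by (simp add: algebra_simps)
  qed
  then show ?thesis unfolding is_Oh_def by blast
qed

lemma is_Oh_minus: "is_Oh n F \<Longrightarrow> is_Oh n (\<lambda>h. - F h)"
  by (simp add: is_Oh_def)

lemma is_Oh_diff: "is_Oh n F \<Longrightarrow> is_Oh n G \<Longrightarrow> is_Oh n (\<lambda>h. F h - G h)"
  using is_Oh_add[of n F "\<lambda>h. - G h"] is_Oh_minus[of n G] by simp

lemma is_Oh_scaleR:
  assumes "is_Oh m a" "is_Oh n F"
  shows "is_Oh (m + n) (\<lambda>h. a h *\<^sub>R F h)"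
proof -
  obtain C where C: "C \<ge> 0" "\<forall>\<^sub>F h in at_right 0. norm (a h) \<le> C * h ^ m"
    using assms is_Oh_nonneg by blast
  obtain D where D: "D \<ge> 0" "\<forall>\<^sub>F h in at_right 0. norm (F h) \<le> D * h ^ n"
    using assms is_Oh_nonneg by blast
  have "\<forall>\<^sub>F h in at_right 0. norm (a h *\<^sub>R F h) \<le> (C * D) * h ^ (m + n)"
    using C(2) D(2) eventually_at_right_less[of "0::real"]
  proof eventually_elim
    case (elim h)
    have "norm (a h *\<^sub>R F h) = norm (a h) * norm (F h)" by simp
    also have "\<dots> \<le> (C * h ^ m) * (D * h ^ n)"
      using elim C(1) by (intro mult_mono) auto
    finally show ?case by (simp add: power_add mult_ac)
  qed
  then show ?thesis unfolding is_Oh_def by blast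
qed

lemma is_Oh_mult: "is_Oh m a \<Longrightarrow> is_Oh n F \<Longrightarrow> is_Oh (m + n) (\<lambda>h. a h * F h :: real)"
  using is_Oh_scaleR[of m a n F] by simp

lemma is_Oh_const: "is_Oh 0 (\<lambda>_. c)"
  unfolding is_Oh_def by (rule exI[of _ "norm c"]) simp

lemma is_Oh_power: "is_Oh n (\<lambda>h::real. h ^ n)"
  unfolding is_Oh_def
  by (rule exI[of _ 1]) (use eventually_at_right_less[of "0::real"] in \<open>auto elim: eventually_mono\<close>)

lemma is_Oh_cmult: "is_Oh n F \<Longrightarrow> is_Oh n (\<lambda>h. c * F h :: real)"
  using is_Oh_mult[OF is_Oh_const, of n F c] by simp

lemma is_Oh_scaleR_const: "is_Oh n a \<Longrightarrow> is_Oh n (\<lambda>h. a h *\<^sub>R v)"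
  using is_Oh_scaleR[OF _ is_Oh_const, of n a v] by simp

lemma is_Oh_cscaleR: "is_Oh n F \<Longrightarrow> is_Oh n (\<lambda>h. c *\<^sub>R F h)"
  using is_Oh_scaleR[OF is_Oh_const, of n F c] by simp

lemma is_Oh_power_scaleR: "is_Oh n F \<Longrightarrow> is_Oh (m + n) (\<lambda>h. h ^ m *\<^sub>R F h)"
  by (rule is_Oh_scaleR[OF is_Oh_power])

lemma is_Oh_bounded_linear:
  assumes "bounded_linear L" "is_Oh n F"
  shows "is_Oh n (\<lambda>h. L (F h))"
proof -
  obtain K where "\<And>x. norm (L x) \<le> norm x * K"
    using bounded_linear.bounded[OF assms(1)] by blast
  then show ?thesis
    by (intro is_Oh_dominated[OF assms(2), of _ K]) (simp add: mult.commute)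
qed

text \<open>The coefficients are expanded in t and used at t = \<open>\<omega> * h\<close>; the
  factor w^n goes into the constant.\<close>

lemma is_Oh_compose_scale:
  assumes "is_Oh n F" "w > 0"
  shows "is_Oh n (\<lambda>h. F (w * h))"
proof -
  obtain C where C: "\<forall>\<^sub>F h in at_right 0. norm (F h) \<le> C * h ^ n"
    using assms unfolding is_Oh_def by blast
  have "filterlim (\<lambda>h. w * h) (at_right 0) (at_right (0::real))"
    unfolding filterlim_at
    using assms(2) eventually_at_right_less[of "0::real"]
    by (auto intro!: tendsto_eq_intros elim: eventually_mono)
  from eventually_compose_filterlim[OF C this]
  have "\<forall>\<^sub>F h in at_right 0. norm (F (w * h)) \<le> (C * w ^ n) * h ^ n"
    by (simp add: power_mult_distrib mult_ac)
  then show ?thesis unfolding is_Oh_def by blast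
qed

text \<open>This reads a coefficient off from an equation q * w = N with N of known order: the
  divisor is at least a multiple of h^m, so the division costs m orders.\<close>

lemma is_Oh_cancel:
  assumes "is_Oh (m + n) (\<lambda>h. q h * w h)" "k > 0" "\<forall>\<^sub>F h in at_right 0. k * h ^ m \<le> \<bar>w h\<bar>"
  shows "is_Oh n (q :: real \<Rightarrow> real)"
proof -
  obtain C where C: "\<forall>\<^sub>F h in at_right 0. norm (q h * w h) \<le> C * h ^ (m + n)"
    using assms(1) unfolding is_Oh_def by blast
  have "\<forall>\<^sub>F h in at_right 0. norm (q h) \<le> (C / k) * h ^ n"
    using C assms(3) eventually_at_right_less[of "0::real"]
  proof eventually_elim
    case (elim h)
    have "\<bar>q h\<bar> * (k * h ^ m) \<le> \<bar>q h\<bar> * \<bar>w h\<bar>"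
      using elim by (intro mult_left_mono) auto
    also have "\<dots> \<le> C * h ^ (m + n)" using elim(1) by (simp add: abs_mult)
    finally have "(\<bar>q h\<bar> * k) * h ^ m \<le> (C * h ^ n) * h ^ m"
      by (simp add: power_add mult_ac)
    then have "\<bar>q h\<bar> * k \<le> C * h ^ n" using elim(3) by simp
    then show ?case using assms(2) by (simp add: field_simps)
  qed
  then show ?thesis unfolding is_Oh_def by blast
qed

lemma is_Oh_tendsto:
  assumes "is_Oh n F" "n > 0"
  shows "(F \<longlongrightarrow> 0) (at_right 0)"
proof -
  obtain C where C: "\<forall>\<^sub>F h in at_right 0. norm (F h) \<le> C * h ^ n"
    using assms unfolding is_Oh_def by blast
  have "((\<lambda>h::real. C * h ^ n) \<longlongrightarrow> C * 0 ^ n) (at_right 0)"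
    by (intro tendsto_intros)
  then show ?thesis
    using assms(2) by (intro Lim_null_comparison[OF C]) (simp add: zero_power)
qed

section \<open>Calculus of maps of class $C^k$\<close>

lemma C_k_on_Suc_D: "C_k_on (Suc k) f U \<Longrightarrow> C_k_on k f U"
proof (induction k arbitrary: f)
  case 0
  then show ?case
    by (auto intro!: continuous_at_imp_continuous_on dest: differentiable_imp_continuous_within)
next
  case (Suc k)
  have "C_k_on (Suc k) (\<lambda>x. frechet_derivative f (at x) v) U" for v
    using Suc.prems by (subst (asm) C_k_on.simps(2)) blast
  then have "C_k_on k (\<lambda>x. frechet_derivative f (at x) v) U" for v
    using Suc.IH by blast
  then show ?case using Suc.prems by (auto simp only: C_k_on.simps)
qed

lemma C_k_on_mono: "C_k_on n f U \<Longrightarrow> m \<le> n \<Longrightarrow> C_k_on m f U"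
  by (induction n rule: nat_induct) (use C_k_on_Suc_D le_Suc_eq in blast)+

lemma C_k_on_imp_continuous: "C_k_on k f U \<Longrightarrow> continuous_on U f"
  using C_k_on_mono[of k f U 0] by simp

lemma C_k_on_has_derivative:
  "C_k_on (Suc k) f U \<Longrightarrow> x \<in> U \<Longrightarrow> (f has_derivative frechet_derivative f (at x)) (at x)"
  by (simp add: frechet_derivative_works)

lemma C_k_on_SucI:
  assumes "\<And>x. x \<in> U \<Longrightarrow> (f has_derivative f' x) (at x)"
    and "\<And>v. C_k_on k (\<lambda>x. frechet_derivative f (at x) v) U"
  shows "C_k_on (Suc k) f U"
  using assms by (auto simp: differentiable_def)

text \<open>The derivative at a point of the open set \<open>U\<close> depends only on nearby
  values, so the derivatives agree on \<open>U\<close> again and the induction proceeds.\<close>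

lemma C_k_on_cong:
  assumes "open U" "\<And>x. x \<in> U \<Longrightarrow> f x = g x" "C_k_on k f U"
  shows "C_k_on k g U"
  using assms(2,3)
proof (induction k arbitrary: f g)
  case 0
  then show ?case by (simp cong: continuous_on_cong)
next
  case (Suc k)
  have g: "(g has_derivative frechet_derivative f (at x)) (at x)" if "x \<in> U" for x
    using C_k_on_has_derivative[OF Suc.prems(2) that]
    by (rule has_derivative_transform_within_open[OF _ assms(1) that]) (use Suc.prems in auto)
  have "C_k_on k (\<lambda>x. frechet_derivative g (at x) v) U" for v
  proof (rule Suc.IH)
    show "C_k_on k (\<lambda>x. frechet_derivative f (at x) v) U" using Suc.prems by simp
    show "frechet_derivative f (at x) v = frechet_derivative g (at x) v" if "x \<in> U" for x
      using frechet_derivative_at[OF g[OF that]] by simp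
  qed
  with g show ?case by (rule C_k_on_SucI)
qed

text \<open>\<open>C_k_on\<close> speaks of the selected \<open>frechet_derivative\<close>; by
  uniqueness of the derivative any formula \<open>f'\<close> produced by the derivative rules may
  stand for it.\<close>

lemma C_k_on_SucI':
  assumes "open U" "\<And>x. x \<in> U \<Longrightarrow> (f has_derivative f' x) (at x)"
    and "\<And>v. C_k_on k (\<lambda>x. f' x v) U"
  shows "C_k_on (Suc k) f U"
proof (rule C_k_on_SucI[OF assms(2)])
  show "C_k_on k (\<lambda>x. frechet_derivative f (at x) v) U" for v
    using frechet_derivative_at[OF assms(2)]
    by (intro C_k_on_cong[OF assms(1) _ assms(3)[of v]]) simp
qed

lemma C_k_on_const: "open U \<Longrightarrow> C_k_on k (\<lambda>_. c) U"
proof (induction k arbitrary: c)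
  case (Suc k)
  then show ?case by (intro C_k_on_SucI'[where f' = "\<lambda>_ _. 0"]) auto
qed simp

lemma C_k_on_add:
  assumes "open U" "C_k_on k f U" "C_k_on k g U"
  shows "C_k_on k (\<lambda>x. f x + g x) U"
  using assms(2,3)
proof (induction k arbitrary: f g)
  case 0
  then show ?case by (auto intro: continuous_intros)
next
  case (Suc k)
  show ?case
  proof (rule C_k_on_SucI'[OF assms(1)])
    show "((\<lambda>x. f x + g x) has_derivative
      (\<lambda>v. frechet_derivative f (at x) v + frechet_derivative g (at x) v)) (at x)" if "x \<in> U" for x
      using Suc.prems that by (intro has_derivative_add C_k_on_has_derivative)
    show "C_k_on k (\<lambda>x. frechet_derivative f (at x) v + frechet_derivative g (at x) v) U" for v
      using Suc.prems by (intro Suc.IH) auto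
  qed
qed

lemma C_k_on_sum:
  assumes "open U" "\<And>i. i \<in> I \<Longrightarrow> C_k_on k (F i) U"
  shows "C_k_on k (\<lambda>x. \<Sum>i\<in>I. F i x) U"
  using assms(2)
  by (induction I rule: infinite_finite_induct) (auto intro: C_k_on_const C_k_on_add assms(1))

lemma C_k_on_scaleR:
  assumes "open U" "C_k_on k u U" "C_k_on k f U"
  shows "C_k_on k (\<lambda>x. u x *\<^sub>R f x) U"
  using assms(2,3)
proof (induction k arbitrary: u f)
  case 0
  then show ?case by (auto intro: continuous_intros)
next
  case (Suc k)
  show ?case
  proof (rule C_k_on_SucI'[OF assms(1)])
    show "((\<lambda>x. u x *\<^sub>R f x) has_derivative
      (\<lambda>v. u x *\<^sub>R frechet_derivative f (at x) v + frechet_derivative u (at x) v *\<^sub>R f x)) (at x)"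
      if "x \<in> U" for x
      using Suc.prems that by (intro has_derivative_scaleR C_k_on_has_derivative)
    show "C_k_on k (\<lambda>x. u x *\<^sub>R frechet_derivative f (at x) v
        + frechet_derivative u (at x) v *\<^sub>R f x) U" for v
      \<comment> \<open>In each product only one factor has lost a derivative; the other is lowered
        from C^(k+1) to C^k to fit the induction hypothesis.\<close>
      using Suc.prems C_k_on_Suc_D[OF Suc.prems(1)] C_k_on_Suc_D[OF Suc.prems(2)]
      by (intro C_k_on_add[OF assms(1)] Suc.IH) auto
  qed
qed

lemma C_k_on_inner_left:
  assumes "open U" "C_k_on k f U"
  shows "C_k_on k (\<lambda>x. f x \<bullet> b) U"
  using assms(2)
proof (induction k arbitrary: f)
  case 0
  then show ?case by (auto intro: continuous_intros)
next
  case (Suc k)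
  show ?case
  proof (rule C_k_on_SucI'[OF assms(1)])
    show "((\<lambda>x. f x \<bullet> b) has_derivative (\<lambda>v. frechet_derivative f (at x) v \<bullet> b)) (at x)"
      if "x \<in> U" for x
      using Suc.prems that by (intro has_derivative_inner_left C_k_on_has_derivative)
    show "C_k_on k (\<lambda>x. frechet_derivative f (at x) v \<bullet> b) U" for v
      using Suc.prems by (intro Suc.IH) auto
  qed
qed

text \<open>The derivative of \<phi> along the flow of \<open>f\<close>. For \<phi> =
  \<open>f\<close> it is \<open>gder f\<close>, and its iterates give the higher derivatives of a
  solution.\<close>

definition lie :: "('a::real_normed_vector \<Rightarrow> 'a) \<Rightarrow> ('a \<Rightarrow> 'b::real_normed_vector) \<Rightarrow> 'a \<Rightarrow> 'b" where
  "lie f \<phi> x = frechet_derivative \<phi> (at x) (f x)"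

text \<open>\<open>C_k_on\<close> controls derivatives in fixed directions, while here the direction
  \<open>f x\<close> moves with x. Expanding it in the basis leaves a finite sum of products of C^k
  functions.\<close>

lemma C_k_on_lie:
  fixes f :: "'a::euclidean_space \<Rightarrow> 'a"
  assumes "open U" "C_k_on k f U" "C_k_on (Suc k) \<phi> U"
  shows "C_k_on k (lie f \<phi>) U"
proof (rule C_k_on_cong[OF assms(1)])
  show "C_k_on k (\<lambda>x. \<Sum>b\<in>Basis. (f x \<bullet> b) *\<^sub>R frechet_derivative \<phi> (at x) b) U"
    using assms by (intro C_k_on_sum C_k_on_scaleR C_k_on_inner_left) auto
  show "(\<Sum>b\<in>Basis. (f x \<bullet> b) *\<^sub>R frechet_derivative \<phi> (at x) b) = lie f \<phi> x" if "x \<in> U" for x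
  proof -
    have lin: "linear (frechet_derivative \<phi> (at x))"
      using C_k_on_has_derivative[OF assms(3) that] has_derivative_linear by blast
    show ?thesis
      unfolding lie_def
      by (subst (2) euclidean_representation[of "f x", symmetric])
        (simp add: linear_sum[OF lin] linear_cmul[OF lin])
  qed
qed

text \<open>Each Lie derivative costs one order of smoothness: for \<open>f\<close> of class C^6 the
  sixth iterate, which gives the seventh derivative of a solution, is still continuous.\<close>

lemma C_k_on_lie_iterate:
  fixes f :: "'a::euclidean_space \<Rightarrow> 'a"
  assumes "open U" "C_k_on k f U" "j \<le> k"
  shows "C_k_on (k - j) ((lie f ^^ j) f) U"
  using assms(3)
proof (induction j)
  case (Suc j)
  then have "C_k_on (Suc (k - Suc j)) ((lie f ^^ j) f) U" by (simp add: Suc_diff_Suc)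
  moreover have "C_k_on (k - Suc j) f U" using assms(2) by (rule C_k_on_mono) simp
  ultimately show ?case using C_k_on_lie[OF assms(1)] by simp
qed (use assms in simp)

lemma solution_lie_derivative:
  assumes "C_k_on (Suc k) \<phi> U" "y t \<in> U" "(y has_vector_derivative f (y t)) (at t within S)"
  shows "((\<lambda>s. \<phi> (y s)) has_vector_derivative lie f \<phi> (y t)) (at t within S)"
proof -
  have "(\<phi> has_derivative frechet_derivative \<phi> (at (y t))) (at (y t) within y ` S)"
    using C_k_on_has_derivative[OF assms(1,2)] by (rule has_derivative_at_withinI)
  from vector_derivative_diff_chain_within[OF assms(3) this] show ?thesis
    by (simp add: lie_def o_def)
qed

lemma taylor_is_Oh:
  fixes D :: "nat \<Rightarrow> real \<Rightarrow> 'a::euclidean_space"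
  assumes "T > 0" "c \<ge> 0" "p > 0"
    and der: "\<And>m t. m < p \<Longrightarrow> t \<in> {a..a + T} \<Longrightarrow>
      (D m has_vector_derivative D (Suc m) t) (at t within {a..a + T})"
    and cont: "continuous_on {a..a + T} (D p)"
  shows "is_Oh p (\<lambda>h. D 0 (a + c * h) - (\<Sum>i<p. ((c * h) ^ i / fact i) *\<^sub>R D i a))"
proof -
  have "bounded (D p ` {a..a + T})"
    by (intro compact_imp_bounded compact_continuous_image cont) simp
  then obtain B where B: "B > 0" "\<And>t. t \<in> {a..a + T} \<Longrightarrow> norm (D p t) \<le> B"
    unfolding bounded_pos by auto
  have small: "\<forall>\<^sub>F h in at_right 0. 0 < h \<and> c * h < T"
  proof (rule eventually_conj[OF eventually_at_right_less])
    have "((\<lambda>h. c * h) \<longlongrightarrow> c * 0) (at_right (0::real))" by (intro tendsto_intros)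
    then show "\<forall>\<^sub>F h in at_right 0. c * h < T"
      using assms(1) by (auto dest: order_tendstoD)
  qed
  have "\<forall>\<^sub>F h in at_right 0. norm (D 0 (a + c * h) - (\<Sum>i<p. ((c * h) ^ i / fact i) *\<^sub>R D i a))
     \<le> (B * c ^ p) * h ^ p"
    using small
  proof eventually_elim
    case (elim h)
    define b where "b = a + c * h"
    have ab: "a \<le> b" and sub: "{a..b} \<subseteq> {a..a + T}" using elim assms(2) by (auto simp: b_def)
    \<comment> \<open>The integral form of the remainder also holds for vectors, unlike the
      mean-value form. Its integrand is at most (b - a)^(p - 1) * B, and the length of the interval
      supplies the last power.\<close>
    have I: "((\<lambda>x. ((b - x) ^ (p - 1) / fact (p - 1)) *\<^sub>R D p x) has_integral
        D 0 b - (\<Sum>i<p. ((b - a) ^ i / fact i) *\<^sub>R D i a)) {a..b}"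
    proof (rule Taylor_has_integral[OF assms(3) refl _ ab])
      show "(D m has_vector_derivative D (Suc m) t) (at t within {a..b})"
        if "m < p" "a \<le> t" "t \<le> b" for m t
        using has_vector_derivative_within_subset[OF der[OF that(1)] sub] that sub by auto
    qed
    have "norm (D 0 b - (\<Sum>i<p. ((b - a) ^ i / fact i) *\<^sub>R D i a))
        \<le> ((b - a) ^ (p - 1) * B) * measure lborel {a..b}"
    proof (rule has_integral_bound_real[OF _ finite.emptyI I])
      show "0 \<le> (b - a) ^ (p - 1) * B" using ab B by auto
      fix x assume "x \<in> {a..b} - {}"
      then have x: "x \<in> {a..b}" by simp
      have "norm (((b - x) ^ (p - 1) / fact (p - 1)) *\<^sub>R D p x)
          = (b - x) ^ (p - 1) / fact (p - 1) * norm (D p x)" using x by simp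
      also have "\<dots> \<le> (b - a) ^ (p - 1) * B"
      proof (rule mult_mono)
        have "(b - x) ^ (p - 1) / fact (p - 1) \<le> (b - x) ^ (p - 1) / 1"
          using x by (intro divide_left_mono) (auto simp: fact_ge_1)
        also have "\<dots> \<le> (b - a) ^ (p - 1)" using x by (auto intro: power_mono)
        finally show "(b - x) ^ (p - 1) / fact (p - 1) \<le> (b - a) ^ (p - 1)" .
      qed (use x sub B ab in auto)
      finally show "norm (((b - x) ^ (p - 1) / fact (p - 1)) *\<^sub>R D p x) \<le> (b - a) ^ (p - 1) * B" .
    qed
    also have "\<dots> = B * (b - a) ^ p"
      using ab assms(3) by (cases p) auto
    finally show ?case by (simp add: b_def power_mult_distrib mult_ac)
  qed
  then show ?thesis unfolding is_Oh_def by blast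
qed


section \<open>Exponential fitting\<close>

text \<open>Away from 0 and from the zeros of the denominators the defining quotients are
  continuous, so filling singularities leaves their values alone.\<close>

lemma remove_sings_isCont: "isCont f z \<Longrightarrow> remove_sings f z = f z"
  by (simp add: remove_sings_eqI isContD)

lemma isCont_Ep [continuous_intros]: "isCont (\<lambda>\<mu>. Ep \<mu> \<zeta>) z"
  and isCont_Em [continuous_intros]: "isCont (\<lambda>\<mu>. Em \<mu> \<zeta>) z"
  unfolding Ep_def Em_def by (intro continuous_intros)+

lemma node_ef_method [simp]:
  "node ef_method (Suc 0) = 0" "node ef_method 2 = c2" "node ef_method 3 = c3"
  by (simp_all add: ef_method_def c1_def)

lemma xi_ef_method [simp]:
  "xi ef_method (Suc 0) \<mu> = 1" "xi ef_method 2 \<mu> = xi2 \<mu>" "xi ef_method 3 \<mu> = xi3 \<mu>"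
  by (simp_all add: ef_method_def xi1_eq)

lemma acoef_ef_method [simp]:
  "acoef ef_method (Suc 0) (Suc 0) \<mu> = 0"
  "acoef ef_method 2 (Suc 0) \<mu> = of_real chi" "acoef ef_method 2 2 \<mu> = a22 \<mu>"
  "acoef ef_method 3 (Suc 0) \<mu> = of_real beta" "acoef ef_method 3 2 \<mu> = of_real delta"
  "acoef ef_method 3 3 \<mu> = a33 \<mu>"
  by (simp_all add: ef_method_def a11_eq)

lemma bcoef_ef_method [simp]:
  "bcoef ef_method (Suc 0) \<mu> = b1 \<mu>" "bcoef ef_method 2 \<mu> = of_real eta"
  "bcoef ef_method 3 \<mu> = b3 \<mu>"
  by (simp_all add: ef_method_def)

lemma stages: "{1..2} = {1, 2::nat}" "{1..3} = {1, 2, 3::nat}" "{Suc 0..2} = {1, 2}" "{Suc 0..3} = {1, 2, 3}"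
  by auto

lemma sqrt5_bounds: "2 < sqrt (5::real)" "sqrt (5::real) < 3"
  by (auto intro: real_less_rsqrt real_less_lsqrt)

lemma c2_pos: "c2 > 0" and c3_pos: "c3 > 0"
  using sqrt5_bounds by (auto simp: c2_def c3_def)

context
  fixes \<mu> :: complex
  assumes nonzero: "\<mu> \<noteq> 0" and denominators: "denominators_nonzero \<mu>"
begin

lemma a22_at:
  "a22 \<mu> = (Ep \<mu> c2 - (2 + of_real chi * \<mu>\<^sup>2 * Ep \<mu> c1)) / (\<mu>\<^sup>2 * Ep \<mu> c2)"
  unfolding a22_def using nonzero denominators
  by (intro remove_sings_isCont continuous_intros) (auto simp: denominators_nonzero_def)

lemma a33_at:
  "a33 \<mu> = (Ep \<mu> c3 - \<mu>\<^sup>2 * (of_real beta * Ep \<mu> c1 + of_real delta * Ep \<mu> c2) - 2) / (\<mu>\<^sup>2 * Ep \<mu> c3)"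
  unfolding a33_def using nonzero denominators
  by (intro remove_sings_isCont continuous_intros) (auto simp: denominators_nonzero_def)

lemma xi2_at:
  "xi2 \<mu> = (Em \<mu> c2 - of_real chi * \<mu>\<^sup>2 * Em \<mu> (c1 - c2)) / (of_real c2 * \<mu> * Ep \<mu> c2)"
  unfolding xi2_def using nonzero denominators c2_pos
  by (intro remove_sings_isCont continuous_intros) (auto simp: denominators_nonzero_def)

lemma xi3_at:
  "xi3 \<mu> = (Em \<mu> c3 - \<mu>\<^sup>2 * (of_real beta * Em \<mu> (c1 - c3) + of_real delta * Em \<mu> (c2 - c3)))
       / (of_real c3 * \<mu> * Ep \<mu> c3)"
  unfolding xi3_def using nonzero denominators c3_pos
  by (intro remove_sings_isCont continuous_intros) (auto simp: denominators_nonzero_def)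

lemma b1_at:
  "b1 \<mu> = (Em \<mu> c3 + Em \<mu> (1 - c3) - \<mu> * Ep \<mu> c3 - of_real eta * \<mu>\<^sup>2 * Em \<mu> (c2 - c3))
       / (\<mu>\<^sup>2 * Em \<mu> (c1 - c3))"
  unfolding b1_def using nonzero denominators
  by (intro remove_sings_isCont continuous_intros) (auto simp: denominators_nonzero_def)

lemma b3_at:
  "b3 \<mu> = (\<mu> * Ep \<mu> c1 - Em \<mu> c1 - Em \<mu> (1 - c1) - of_real eta * \<mu>\<^sup>2 * Em \<mu> (c1 - c2))
       / (\<mu>\<^sup>2 * Em \<mu> (c1 - c3))"
  unfolding b3_def using nonzero denominators
  by (intro remove_sings_isCont continuous_intros) (auto simp: denominators_nonzero_def)

text \<open>The two signs form a 2x2 linear system for the unknowns \<open>A\<close> and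
  \<open>x\<close> with determinant - X, and the coefficient formulas are its solution by Cramer's
  rule; this explains the denominator \<open>Ep \<mu> c2\<close>.\<close>

lemma fitted_stage2:
  assumes "s \<in> {1, -1}"
  shows "\<mu>\<^sup>2 * (of_real chi + a22 \<mu> * exp (s * of_real c2 * \<mu>)) + s * xi2 \<mu> * of_real c2 * \<mu>
    = exp (s * of_real c2 * \<mu>) - 1"
proof -
  define P p where "P = exp (of_real c2 * \<mu>)" and "p = exp (- of_real c2 * \<mu>)"
  define X where "X = P + p"
  define A x where "A = \<mu>\<^sup>2 * a22 \<mu>" and "x = xi2 \<mu> * of_real c2 * \<mu>"
  define k m :: complex where "k = of_real chi" and "m = \<mu>\<^sup>2"
  have P: "P * p = 1" by (simp add: P_def p_def flip: exp_add)
  have X: "Ep \<mu> c2 = X" "X \<noteq> 0"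
    using denominators by (auto simp: denominators_nonzero_def Ep_def X_def P_def p_def)
  have E: "Ep \<mu> c1 = 2" "Em \<mu> c2 = P - p" "Em \<mu> (c1 - c2) = p - P"
    by (simp_all add: Ep_def Em_def c1_def P_def p_def)
  have A: "A * X = X - 2 - 2 * k * m"
    using nonzero X by (simp add: A_def a22_at E k_def m_def)
  have x: "x * X = P - p - k * m * (p - P)"
    using nonzero X c2_pos by (simp add: x_def xi2_at E k_def m_def)
  \<comment> \<open>Multiplied by \<open>X\<close>, the fitting equations are polynomial
    consequences of the relations collected above; then the nonzero \<open>X\<close> is
    cancelled.\<close>
  have "X * (m * k + A * P + x) = X * (P - 1)" "X * (m * k + A * p - x) = X * (p - 1)"
    using A x P X_def by algebra+
  then have "m * k + A * P + x = P - 1" "m * k + A * p - x = p - 1" using X by auto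
  then show ?thesis
    using assms by (auto simp: P_def p_def A_def x_def k_def m_def algebra_simps)
qed

text \<open>The terms with \<open>beta\<close> and \<open>delta\<close> are known data, so the
  system again has two unknowns, now with determinant minus \<open>Ep \<mu> c3\<close>.\<close>

lemma fitted_stage3:
  assumes "s \<in> {1, -1}"
  shows "\<mu>\<^sup>2 * (of_real beta + of_real delta * exp (s * of_real c2 * \<mu>)
      + a33 \<mu> * exp (s * of_real c3 * \<mu>)) + s * xi3 \<mu> * of_real c3 * \<mu>
    = exp (s * of_real c3 * \<mu>) - 1"
proof -
  define Q q where "Q = exp (of_real c2 * \<mu>)" and "q = exp (- of_real c2 * \<mu>)"
  define P p where "P = exp (of_real c3 * \<mu>)" and "p = exp (- of_real c3 * \<mu>)"
  define X where "X = P + p"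
  define A x where "A = \<mu>\<^sup>2 * a33 \<mu>" and "x = xi3 \<mu> * of_real c3 * \<mu>"
  define k l m :: complex where "k = of_real beta" and "l = of_real delta" and "m = \<mu>\<^sup>2"
  have P: "P * p = 1" by (simp add: P_def p_def flip: exp_add)
  have X: "Ep \<mu> c3 = X" "X \<noteq> 0"
    using denominators by (auto simp: denominators_nonzero_def Ep_def X_def P_def p_def)
  have E: "Ep \<mu> c1 = 2" "Ep \<mu> c2 = Q + q" "Em \<mu> c3 = P - p"
    "Em \<mu> (c1 - c3) = p - P" "Em \<mu> (c2 - c3) = Q * p - P * q"
    by (simp_all add: Ep_def Em_def c1_def P_def Q_def p_def q_def algebra_simps flip: exp_add)
  have A: "A * X = X - 2 - m * (2 * k + l * (Q + q))"
    using nonzero X by (simp add: A_def a33_at E k_def l_def m_def)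
  have x: "x * X = P - p - m * (k * (p - P) + l * (Q * p - P * q))"
    using nonzero X c3_pos by (simp add: x_def xi3_at E k_def l_def m_def)
  have "X * (m * (k + l * Q) + A * P + x) = X * (P - 1)"
    "X * (m * (k + l * q) + A * p - x) = X * (p - 1)"
    using A x P X_def by algebra+
  then have "m * (k + l * Q) + A * P + x = P - 1" "m * (k + l * q) + A * p - x = p - 1"
    using X by auto
  then show ?thesis
    using assms by (auto simp: P_def Q_def p_def q_def A_def x_def k_def l_def m_def algebra_simps)
qed

text \<open>The unknowns are now \<open>A\<close> and \<open>B\<close>, with columns (1, 1) and (P,
  p); since \<open>c1\<close> is 0, the determinant p - P is exactly
  \<open>Em \<mu> (c1 - c3)\<close>.\<close>

lemma fitted_final:
  assumes "s \<in> {1, -1}"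
  shows "\<mu>\<^sup>2 * (b1 \<mu> + of_real eta * exp (s * of_real c2 * \<mu>) + b3 \<mu> * exp (s * of_real c3 * \<mu>))
    = exp (s * \<mu>) - 1 - s * \<mu>"
proof -
  define Q q where "Q = exp (of_real c2 * \<mu>)" and "q = exp (- of_real c2 * \<mu>)"
  define P p where "P = exp (of_real c3 * \<mu>)" and "p = exp (- of_real c3 * \<mu>)"
  define R r where "R = exp \<mu>" and "r = exp (- \<mu>)"
  define X where "X = p - P"
  define A B where "A = \<mu>\<^sup>2 * b1 \<mu>" and "B = \<mu>\<^sup>2 * b3 \<mu>"
  define k m :: complex where "k = of_real eta" and "m = \<mu>\<^sup>2"
  have P: "P * p = 1" by (simp add: P_def p_def flip: exp_add)
  have X: "Em \<mu> (c1 - c3) = X" "X \<noteq> 0"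
    using denominators by (auto simp: denominators_nonzero_def Em_def c1_def X_def P_def p_def)
  have E: "Ep \<mu> c1 = 2" "Em \<mu> c1 = 0" "Ep \<mu> c3 = P + p" "Em \<mu> c3 = P - p"
    "Em \<mu> (1 - c1) = R - r" "Em \<mu> (1 - c3) = R * p - P * r"
    "Em \<mu> (c1 - c2) = q - Q" "Em \<mu> (c2 - c3) = Q * p - P * q"
    by (simp_all add: Ep_def Em_def c1_def P_def Q_def R_def p_def q_def r_def algebra_simps
        flip: exp_add)
  have A: "A * X = P - p + (R * p - P * r) - \<mu> * (P + p) - k * m * (Q * p - P * q)"
    using nonzero X by (simp add: A_def b1_at E k_def m_def)
  have B: "B * X = 2 * \<mu> - (R - r) - k * m * (q - Q)"
    using nonzero X by (simp add: B_def b3_at E k_def m_def)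
  have "X * (A + m * k * Q + B * P) = X * (R - 1 - \<mu>)"
    "X * (A + m * k * q + B * p) = X * (r - 1 + \<mu>)"
    using A B P X_def by algebra+
  then have "A + m * k * Q + B * P = R - 1 - \<mu>" "A + m * k * q + B * p = r - 1 + \<mu>"
    using X by auto
  then show ?thesis
    using assms by (auto simp: P_def Q_def R_def p_def q_def r_def A_def B_def k_def m_def algebra_simps)
qed

lemma ef_method_exp_fitted: "exp_fitted_at ef_method \<mu>"
  unfolding exp_fitted_at_def
proof (intro ballI conjI)
  fix s :: complex assume s: "s \<in> {1, -1}"
  show "\<mu>\<^sup>2 * (\<Sum>i=1..3. bcoef ef_method i \<mu> * exp (s * of_real (node ef_method i) * \<mu>))
      = exp (s * \<mu>) - 1 - s * \<mu>"
    using fitted_final[OF s] by (simp add: stages add.assoc)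
  fix i :: nat assume "i \<in> {1..3}"
  then consider "i = 1" | "i = 2" | "i = 3" by (auto simp: stages)
  then show "\<mu>\<^sup>2 * (\<Sum>j=1..i. acoef ef_method i j \<mu> * exp (s * of_real (node ef_method j) * \<mu>))
      + s * xi ef_method i \<mu> * of_real (node ef_method i) * \<mu>
    = exp (s * of_real (node ef_method i) * \<mu>) - 1"
    by cases (use fitted_stage2[OF s] fitted_stage3[OF s] in \<open>simp_all add: stages add.assoc\<close>)
qed

end


section \<open>Asymptotic expansion of the coefficients\<close>

lemma is_Oh_sin_remainder: "is_Oh n (\<lambda>t. sin (c * t) - (\<Sum>m<n. sin_coeff m * (c * t) ^ m))"
  unfolding is_Oh_def
proof (rule exI, rule eventually_mono[OF eventually_at_right_less])
  fix t :: real assume "0 < t"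
  then show "norm (sin (c * t) - (\<Sum>m<n. sin_coeff m * (c * t) ^ m))
      \<le> (inverse (fact n) * \<bar>c\<bar> ^ n) * t ^ n"
    using Maclaurin_sin_bound[of "c * t" n] by (simp add: abs_mult power_mult_distrib mult_ac)
qed

lemma is_Oh_cos_remainder: "is_Oh n (\<lambda>t. cos (c * t) - (\<Sum>m<n. cos_coeff m * (c * t) ^ m))"
  unfolding is_Oh_def
proof (rule exI, rule eventually_mono[OF eventually_at_right_less])
  fix t :: real assume "0 < t"
  obtain u where u: "cos (c * t) = (\<Sum>m<n. cos_coeff m * (c * t) ^ m)
      + (cos (u + 1/2 * real n * pi) / fact n) * (c * t) ^ n"
    using Maclaurin_cos_expansion[of "c * t" n] by blast
  then have "norm (cos (c * t) - (\<Sum>m<n. cos_coeff m * (c * t) ^ m))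
      = \<bar>cos (u + 1/2 * real n * pi)\<bar> * (\<bar>c * t\<bar> ^ n / fact n)"
    by (simp add: abs_mult power_abs)
  also have "\<dots> \<le> 1 * (\<bar>c * t\<bar> ^ n / fact n)"
    by (intro mult_right_mono) auto
  finally show "norm (cos (c * t) - (\<Sum>m<n. cos_coeff m * (c * t) ^ m))
      \<le> (\<bar>c\<bar> ^ n / fact n) * t ^ n"
    using \<open>0 < t\<close> by (simp add: abs_mult power_mult_distrib)
qed

text \<open>Every second Maclaurin coefficient vanishes, so the order of the remainder exceeds the
  degree of the polynomial by two.\<close>

lemma is_Oh_sin3: "is_Oh 3 (\<lambda>t. sin (c * t) - c * t)"
  and is_Oh_sin5: "is_Oh 5 (\<lambda>t. sin (c * t) - (c * t - (c * t) ^ 3 / 6))"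
  and is_Oh_sin7: "is_Oh 7 (\<lambda>t. sin (c * t) - (c * t - (c * t) ^ 3 / 6 + (c * t) ^ 5 / 120))"
proof -
  have "(\<Sum>m<3. sin_coeff m * x ^ m) = x"
    "(\<Sum>m<5. sin_coeff m * x ^ m) = x - x ^ 3 / 6"
    "(\<Sum>m<7. sin_coeff m * x ^ m) = x - x ^ 3 / 6 + x ^ 5 / 120" for x :: real
    by (simp_all add: sin_coeff_def lessThan_nat_numeral lessThan_Suc fact_numeral)
  with is_Oh_sin_remainder[of 3 c] is_Oh_sin_remainder[of 5 c] is_Oh_sin_remainder[of 7 c]
  show "is_Oh 3 (\<lambda>t. sin (c * t) - c * t)"
    "is_Oh 5 (\<lambda>t. sin (c * t) - (c * t - (c * t) ^ 3 / 6))"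
    "is_Oh 7 (\<lambda>t. sin (c * t) - (c * t - (c * t) ^ 3 / 6 + (c * t) ^ 5 / 120))"
    by simp_all
qed

lemma is_Oh_cos2: "is_Oh 2 (\<lambda>t. cos (c * t) - 1)"
  and is_Oh_cos4: "is_Oh 4 (\<lambda>t. cos (c * t) - (1 - (c * t) ^ 2 / 2))"
  and is_Oh_cos6: "is_Oh 6 (\<lambda>t. cos (c * t) - (1 - (c * t) ^ 2 / 2 + (c * t) ^ 4 / 24))"
  and is_Oh_cos8: "is_Oh 8 (\<lambda>t. cos (c * t) - (1 - (c * t) ^ 2 / 2 + (c * t) ^ 4 / 24 - (c * t) ^ 6 / 720))"
proof -
  have "(\<Sum>m<2. cos_coeff m * x ^ m) = 1"
    "(\<Sum>m<4. cos_coeff m * x ^ m) = 1 - x ^ 2 / 2"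
    "(\<Sum>m<6. cos_coeff m * x ^ m) = 1 - x ^ 2 / 2 + x ^ 4 / 24"
    "(\<Sum>m<8. cos_coeff m * x ^ m) = 1 - x ^ 2 / 2 + x ^ 4 / 24 - x ^ 6 / 720" for x :: real
    by (simp_all add: cos_coeff_def lessThan_nat_numeral lessThan_Suc fact_numeral)
  with is_Oh_cos_remainder[of 2 c] is_Oh_cos_remainder[of 4 c] is_Oh_cos_remainder[of 6 c]
    is_Oh_cos_remainder[of 8 c]
  show "is_Oh 2 (\<lambda>t. cos (c * t) - 1)" "is_Oh 4 (\<lambda>t. cos (c * t) - (1 - (c * t) ^ 2 / 2))"
    "is_Oh 6 (\<lambda>t. cos (c * t) - (1 - (c * t) ^ 2 / 2 + (c * t) ^ 4 / 24))"
    "is_Oh 8 (\<lambda>t. cos (c * t) - (1 - (c * t) ^ 2 / 2 + (c * t) ^ 4 / 24 - (c * t) ^ 6 / 720))"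
    by simp_all
qed

text \<open>A lower bound on divisors for \<open>is_Oh_cancel\<close>: the slope at 0 is c, and c /
  2 lies strictly below it.\<close>

lemma sin_lower_bound:
  fixes c :: real
  assumes "c > 0"
  shows "\<forall>\<^sub>F t in at_right 0. c / 2 * t ^ 1 \<le> \<bar>sin (c * t)\<bar>"
proof -
  have "((\<lambda>t. sin (c * t)) has_real_derivative c) (at 0)"
    by (auto intro!: derivative_eq_intros)
  then have "((\<lambda>t. sin (c * t) / t) \<longlongrightarrow> c) (at 0)"
    by (simp add: DERIV_def)
  then have "((\<lambda>t. sin (c * t) / t) \<longlongrightarrow> c) (at_right 0)"
    by (rule tendsto_within_subset) simp
  then have "\<forall>\<^sub>F t in at_right 0. c / 2 < sin (c * t) / t"
    by (rule order_tendstoD) (use assms in simp)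
  with eventually_at_right_less show ?thesis
    by eventually_elim (auto simp: field_simps)
qed

lemma cos_lower_bound:
  fixes c :: real
  shows "\<forall>\<^sub>F t in at_right 0. 1 / 2 \<le> cos (c * t)"
proof -
  have "((\<lambda>t. cos (c * t)) \<longlongrightarrow> cos (c * 0)) (at_right 0)" by (intro tendsto_intros)
  then have "\<forall>\<^sub>F t in at_right 0. 1 / 2 < cos (c * t)"
    by (rule order_tendstoD) simp
  then show ?thesis by (auto elim: eventually_mono)
qed

text \<open>
  \<open>A22\<close>, \<open>A33\<close>, \<open>B3\<close> are the values of \<open>a22\<close>, \<open>a33\<close>, \<open>b3\<close> at $\mu = 0$; \<open>K2\<close> and \<open>K3\<close> are the
  coefficients of $h^4 y^{(4)}$ in the residuals of the stages at $\mu = 0$.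
\<close>

definition A22 :: real where "A22 = (3 - sqrt 5) / 60"
definition A33 :: real where "A33 = (3 - sqrt 5) / 60"
definition B3 :: real where "B3 = (5 - sqrt 5) / 24"
definition K2 :: real where "K2 = c2 ^ 4 / 24 - A22 * c2\<^sup>2 / 2"
definition K3 :: real where "K3 = c3 ^ 4 / 24 - (delta * c2\<^sup>2 + A33 * c3\<^sup>2) / 2"

lemmas constants = c2_def c3_def chi_def beta_def delta_def eta_def A22_def A33_def B3_def

text \<open>The right-hand sides are the integrals of c - s and (c - s) s over [0, c]: at frequency
  zero a stage reproduces y through h^3. The next condition, for (c - s) s^2, fails, and
  \<open>K2\<close>, \<open>K3\<close> are half its defects.\<close>

lemma stage_conditions:
  "chi + A22 = c2\<^sup>2 / 2" "A22 * c2 = c2 ^ 3 / 6"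
  "beta + delta + A33 = c3\<^sup>2 / 2" "delta * c2 + A33 * c3 = c3 ^ 3 / 6"
proof -
  define s :: real where "s = sqrt 5"
  have s: "s * s = 5" by (simp add: s_def)
  \<comment> \<open>The relation s * s = 5 does not rewrite products nested to the right; this form
    does.\<close>
  have "s * (s * x) = 5 * x" for x using s by (metis mult.assoc)
  with s show "chi + A22 = c2\<^sup>2 / 2" "A22 * c2 = c2 ^ 3 / 6"
    "beta + delta + A33 = c3\<^sup>2 / 2" "delta * c2 + A33 * c3 = c3 ^ 3 / 6"
    unfolding constants s_def[symmetric]
    by (simp_all add: power2_eq_square power3_eq_cube field_simps)
qed

text \<open>The first four are the moments 1 / ((k + 1) (k + 2)) of s^k against 1 - s on [0, 1] for
  k = 1, ..., 4; the node 0 does not contribute to them. The last is the condition under which the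
  two stage residuals cancel.\<close>

lemma quadrature_conditions:
  "eta * c2 + B3 * c3 = 1 / 6" "eta * c2\<^sup>2 + B3 * c3\<^sup>2 = 1 / 12"
  "eta * c2 ^ 3 + B3 * c3 ^ 3 = 1 / 20" "eta * c2 ^ 4 + B3 * c3 ^ 4 = 1 / 30"
  "eta * K2 + B3 * K3 = 0"
proof -
  define s :: real where "s = sqrt 5"
  have s: "s * s = 5" by (simp add: s_def)
  have ss: "s * (s * x) = 5 * x" for x using s by (metis mult.assoc)
  have c: "c2\<^sup>2 = (3 - s) / 10" "c3\<^sup>2 = (3 + s) / 10"
    "c2 ^ 3 = (5 - 2 * s) / 25" "c3 ^ 3 = (5 + 2 * s) / 25"
    "c2 ^ 4 = (7 - 3 * s) / 50" "c3 ^ 4 = (7 + 3 * s) / 50"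
    unfolding constants s_def[symmetric] using s ss
    by (simp_all add: eval_nat_numeral field_simps)
  show "eta * c2 + B3 * c3 = 1 / 6" "eta * c2\<^sup>2 + B3 * c3\<^sup>2 = 1 / 12"
    "eta * c2 ^ 3 + B3 * c3 ^ 3 = 1 / 20" "eta * c2 ^ 4 + B3 * c3 ^ 4 = 1 / 30"
    unfolding c unfolding constants s_def[symmetric] using s ss
    by (simp_all add: field_simps)
  have K: "K2 = - (7 - 3 * s) / 1200" "K3 = (3 - s) / 1200"
    unfolding K2_def K3_def c unfolding constants s_def[symmetric] using s ss
    by (simp_all add: field_simps)
  show "eta * K2 + B3 * K3 = 0"
    unfolding K unfolding constants s_def[symmetric] using s by (simp add: field_simps)
qed

section \<open>The fitting conditions in real form\<close>

definition a22r where "a22r t = Re (a22 (\<i> * of_real t))"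
definition a33r where "a33r t = Re (a33 (\<i> * of_real t))"
definition xi2r where "xi2r t = Re (xi2 (\<i> * of_real t))"
definition xi3r where "xi3r t = Re (xi3 (\<i> * of_real t))"
definition b1r where "b1r t = Re (b1 (\<i> * of_real t))"
definition b3r where "b3r t = Re (b3 (\<i> * of_real t))"

lemma real_coefficients:
  "a22 (\<i> * of_real t) = of_real (a22r t)" "a33 (\<i> * of_real t) = of_real (a33r t)"
  "xi2 (\<i> * of_real t) = of_real (xi2r t)" "xi3 (\<i> * of_real t) = of_real (xi3r t)"
  "b1 (\<i> * of_real t) = of_real (b1r t)" "b3 (\<i> * of_real t) = of_real (b3r t)"
  using ef_method_real(1)[of 2 t] ef_method_real(1)[of 3 t] ef_method_real(2)[of 2 2 t]
    ef_method_real(2)[of 3 3 t] ef_method_real(3)[of 1 t] ef_method_real(3)[of 3 t]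
  by (auto simp: a22r_def a33r_def xi2r_def xi3r_def b1r_def b3r_def)

lemma eventually_denominators_nonzero:
  "\<forall>\<^sub>F t in at_right 0. denominators_nonzero (\<i> * of_real t)"
  using cos_lower_bound[of c2] cos_lower_bound[of c3] sin_lower_bound[OF c3_pos]
    eventually_at_right_less[of "0::real"]
proof eventually_elim
  case (elim t)
  have "c3 / 2 * t ^ 1 > 0" using elim(4) c3_pos by simp
  then have "sin (c3 * t) \<noteq> 0" using elim(3) by auto
  then show ?case
    using elim by (auto simp: denominators_nonzero_def Ep_imaginary Em_imaginary c1_def)
qed

lemma exp_imaginary:
  "exp (of_real c * (\<i> * of_real t)) = of_real (cos (c * t)) + \<i> * of_real (sin (c * t))"
    "exp (\<i> * of_real t) = of_real (cos t) + \<i> * of_real (sin t)"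
  by (simp_all add: complex_eq_iff Re_exp Im_exp)

context
  fixes t :: real
  assumes t: "t > 0" "denominators_nonzero (\<i> * of_real t)"
begin

text \<open>One sign carries everything: the coefficients are real at imaginary argument, so the
  equation for s = -1 is the complex conjugate of that for s = 1. Real and imaginary part give the
  two lines.\<close>

lemma trig_fitted_stage2:
  "t\<^sup>2 * (chi + a22r t * cos (c2 * t)) = 1 - cos (c2 * t)"
  "xi2r t * c2 * t = sin (c2 * t) + t\<^sup>2 * (a22r t * sin (c2 * t))"
  using fitted_stage2[OF _ t(2), of 1, unfolded mult_1_left exp_imaginary real_coefficients] t(1)
  by (auto simp: complex_eq_iff power2_eq_square algebra_simps)

lemma trig_fitted_stage3:
  "t\<^sup>2 * (beta + delta * cos (c2 * t) + a33r t * cos (c3 * t)) = 1 - cos (c3 * t)"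
  "xi3r t * c3 * t = sin (c3 * t) + t\<^sup>2 * (delta * sin (c2 * t) + a33r t * sin (c3 * t))"
  using fitted_stage3[OF _ t(2), of 1, unfolded mult_1_left exp_imaginary real_coefficients] t(1)
  by (auto simp: complex_eq_iff power2_eq_square algebra_simps)

lemma trig_fitted_final:
  "t\<^sup>2 * (b1r t + eta * cos (c2 * t) + b3r t * cos (c3 * t)) = 1 - cos t"
  "t\<^sup>2 * (eta * sin (c2 * t) + b3r t * sin (c3 * t)) = t - sin t"
  using fitted_final[OF _ t(2), of 1, unfolded mult_1_left exp_imaginary real_coefficients] t(1)
  by (auto simp: complex_eq_iff power2_eq_square algebra_simps)

end

lemma eventually_trig_fitted:
  "\<forall>\<^sub>F t in at_right 0. t > 0 \<and> denominators_nonzero (\<i> * of_real t)"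
  using eventually_at_right_less eventually_denominators_nonzero by (rule eventually_conj)

text \<open>In the sine equation \<open>b3\<close> is the only unknown coefficient, because the node
  of \<open>b1\<close> is 0. The moments of s and s^3 remove t^3 and t^5, leaving O(t^7), and the
  divisor costs three powers.\<close>

lemma b3r_expansion: "is_Oh 4 (\<lambda>t. b3r t - B3)"
proof (rule is_Oh_cancel[where m = 3])
  \<comment> \<open>What the sine equation leaves over when \<open>b3\<close> is replaced by
    \<open>B3\<close>. The spelling \<open>1 * t\<close> matches \<open>is_Oh_sin7\<close> at c =
    1.\<close>
  define N where "N t = t - sin (1 * t) - t\<^sup>2 * (eta * sin (c2 * t)) - t\<^sup>2 * (B3 * sin (c3 * t))" for t
  have "is_Oh (2 + 5) (\<lambda>t. t ^ 2 * (eta * (sin (c2 * t) - (c2 * t - (c2 * t) ^ 3 / 6))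
        + B3 * (sin (c3 * t) - (c3 * t - (c3 * t) ^ 3 / 6))))"
    by (intro is_Oh_mult is_Oh_power is_Oh_add is_Oh_cmult is_Oh_sin5)
  then have "is_Oh 7 (\<lambda>t. - ((sin (1 * t) - (1 * t - (1 * t) ^ 3 / 6 + (1 * t) ^ 5 / 120))
      + t ^ 2 * (eta * (sin (c2 * t) - (c2 * t - (c2 * t) ^ 3 / 6))
        + B3 * (sin (c3 * t) - (c3 * t - (c3 * t) ^ 3 / 6)))))"
    by (intro is_Oh_minus is_Oh_add is_Oh_sin7) auto
  moreover have "- ((sin (1 * t) - (1 * t - (1 * t) ^ 3 / 6 + (1 * t) ^ 5 / 120))
      + t ^ 2 * (eta * (sin (c2 * t) - (c2 * t - (c2 * t) ^ 3 / 6))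
        + B3 * (sin (c3 * t) - (c3 * t - (c3 * t) ^ 3 / 6)))) = N t" for t
  proof -
    have "eta * c2 * t ^ 3 + B3 * c3 * t ^ 3 = t ^ 3 / 6"
      "eta * c2 ^ 3 * t ^ 5 + B3 * c3 ^ 3 * t ^ 5 = t ^ 5 / 20"
      using quadrature_conditions(1,3) by (metis distrib_right divide_inverse inverse_eq_divide mult.commute)+
    then show ?thesis
      unfolding N_def by (simp add: algebra_simps eval_nat_numeral)
  qed
  ultimately have "is_Oh 7 N" by simp
  moreover have "\<forall>\<^sub>F t in at_right 0. N t = (b3r t - B3) * (t\<^sup>2 * sin (c3 * t))"
    using eventually_trig_fitted
  proof eventually_elim
    case (elim t)
    then show ?case using trig_fitted_final(2)[of t] by (simp add: N_def algebra_simps)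
  qed
  ultimately show "is_Oh (3 + 4) (\<lambda>t. (b3r t - B3) * (t\<^sup>2 * sin (c3 * t)))"
    by simp (rule is_Oh_cong)
  show "\<forall>\<^sub>F t in at_right 0. c3 / 2 * t ^ 3 \<le> \<bar>t\<^sup>2 * sin (c3 * t)\<bar>"
    using sin_lower_bound[OF c3_pos]
  proof eventually_elim
    case (elim t)
    have "t\<^sup>2 * (c3 / 2 * t ^ 1) \<le> t\<^sup>2 * \<bar>sin (c3 * t)\<bar>" by (rule mult_left_mono[OF elim]) simp
    then show ?case by (simp add: abs_mult eval_nat_numeral mult_ac)
  qed
  show "c3 / 2 > 0" using c3_pos by simp
qed


text \<open>Writing each cosine as 1 + (cos - 1) puts the whole sum of weights in front of t^2,
  while the deviation of \<open>b3\<close> gets an extra factor O(t^2). With the moments of s^2 and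
  s^4 everything else is O(t^8), so the sum is more accurate than \<open>b3\<close> itself.\<close>

lemma b1r_expansion: "is_Oh 5 (\<lambda>t. b1r t + eta + b3r t - 1 / 2)" "is_Oh 4 (\<lambda>t. b1r t - 1 / 12)"
proof -
  define N where "N t = (1 - cos (1 * t)) - t\<^sup>2 / 2 - t\<^sup>2 * (eta * (cos (c2 * t) - 1))
    - t\<^sup>2 * (B3 * (cos (c3 * t) - 1))" for t
  have "is_Oh (2 + 6) (\<lambda>t. t ^ 2 * (eta * (cos (c2 * t) - (1 - (c2 * t) ^ 2 / 2 + (c2 * t) ^ 4 / 24))
        + B3 * (cos (c3 * t) - (1 - (c3 * t) ^ 2 / 2 + (c3 * t) ^ 4 / 24))))"
    by (intro is_Oh_mult is_Oh_power is_Oh_add is_Oh_cmult is_Oh_cos6)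
  then have "is_Oh 8 (\<lambda>t. - ((cos (1 * t) - (1 - (1 * t) ^ 2 / 2 + (1 * t) ^ 4 / 24 - (1 * t) ^ 6 / 720))
      + t ^ 2 * (eta * (cos (c2 * t) - (1 - (c2 * t) ^ 2 / 2 + (c2 * t) ^ 4 / 24))
        + B3 * (cos (c3 * t) - (1 - (c3 * t) ^ 2 / 2 + (c3 * t) ^ 4 / 24)))))"
    by (intro is_Oh_minus is_Oh_add is_Oh_cos8) auto
  moreover have "- ((cos (1 * t) - (1 - (1 * t) ^ 2 / 2 + (1 * t) ^ 4 / 24 - (1 * t) ^ 6 / 720))
      + t ^ 2 * (eta * (cos (c2 * t) - (1 - (c2 * t) ^ 2 / 2 + (c2 * t) ^ 4 / 24))
        + B3 * (cos (c3 * t) - (1 - (c3 * t) ^ 2 / 2 + (c3 * t) ^ 4 / 24)))) = N t" for t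
  proof -
    have "eta * c2 ^ 2 * t ^ 4 + B3 * c3 ^ 2 * t ^ 4 = t ^ 4 / 12"
      "eta * c2 ^ 4 * t ^ 6 + B3 * c3 ^ 4 * t ^ 6 = t ^ 6 / 30"
      using quadrature_conditions(2,4) by (metis distrib_right divide_inverse inverse_eq_divide mult.commute)+
    then show ?thesis
      unfolding N_def by (simp add: algebra_simps eval_nat_numeral)
  qed
  ultimately have N: "is_Oh 8 N" by simp
  have "is_Oh (2 + (4 + 2)) (\<lambda>t. t ^ 2 * ((b3r t - B3) * (cos (c3 * t) - 1)))"
    by (intro is_Oh_mult is_Oh_power b3r_expansion is_Oh_cos2)
  then have "is_Oh 8 (\<lambda>t. N t - t\<^sup>2 * ((b3r t - B3) * (cos (c3 * t) - 1)))"
    by (intro is_Oh_diff N) simp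
  moreover have "\<forall>\<^sub>F t in at_right 0. N t - t\<^sup>2 * ((b3r t - B3) * (cos (c3 * t) - 1))
      = (b1r t + eta + b3r t - 1 / 2) * t\<^sup>2"
    using eventually_trig_fitted
  proof eventually_elim
    case (elim t)
    then show ?case using trig_fitted_final(1)[of t] by (simp add: N_def algebra_simps)
  qed
  ultimately have *: "is_Oh (2 + 6) (\<lambda>t. (b1r t + eta + b3r t - 1 / 2) * t\<^sup>2)"
    by simp (rule is_Oh_cong)
  have "is_Oh 6 (\<lambda>t. b1r t + eta + b3r t - 1 / 2)"
    by (rule is_Oh_cancel[OF *, of 1]) auto
  then show 5: "is_Oh 5 (\<lambda>t. b1r t + eta + b3r t - 1 / 2)"
    by (rule is_Oh_mono) simp
  have "is_Oh 4 (\<lambda>t. (b1r t + eta + b3r t - 1 / 2) - (b3r t - B3))"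
    by (intro is_Oh_diff b3r_expansion is_Oh_mono[OF 5]) simp
  moreover have "eta + B3 = 5 / 12" by (simp add: eta_def B3_def add_divide_distrib diff_divide_distrib)
  then have "(b1r t + eta + b3r t - 1 / 2) - (b3r t - B3) = b1r t - 1 / 12" for t by simp
  ultimately show "is_Oh 4 (\<lambda>t. b1r t - 1 / 12)" by simp
qed

text \<open>Shared by both stages; stage 2 is the case l = d = 0. The condition on l * d + A * c
  cancels the t^3 terms, and division of the O(t^5) rest by c t leaves order 4.\<close>

lemma xi_expansion:
  fixes \<xi> \<alpha> :: "real \<Rightarrow> real"
  assumes "c > 0"
    and fitted: "\<forall>\<^sub>F t in at_right 0. \<xi> t * c * t = sin (c * t) + t\<^sup>2 * (l * sin (d * t) + \<alpha> t * sin (c * t))"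
    and \<alpha>: "is_Oh 2 (\<lambda>t. \<alpha> t - A)" and cond: "l * d + A * c = c ^ 3 / 6"
  shows "is_Oh 4 (\<lambda>t. \<xi> t - 1)"
proof (rule is_Oh_cancel[where m = 1])
  have "is_Oh (2 + 3) (\<lambda>t. t ^ 2 * (l * (sin (d * t) - d * t) + A * (sin (c * t) - c * t)))"
    by (intro is_Oh_mult is_Oh_power is_Oh_add is_Oh_cmult is_Oh_sin3)
  \<comment> \<open>The sine is split into its O(t^3) remainder and c t, which shows it to be
    O(t).\<close>
  moreover have "is_Oh (2 + (2 + 1)) (\<lambda>t. t ^ 2 * ((\<alpha> t - A) * (sin (c * t) - c * t + c * t)))"
    using is_Oh_cmult[OF is_Oh_power[of 1], of c]
    by (intro is_Oh_mult is_Oh_power \<alpha> is_Oh_add is_Oh_mono[OF is_Oh_sin3]) auto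
  ultimately have "is_Oh 5 (\<lambda>t. (sin (c * t) - (c * t - (c * t) ^ 3 / 6))
      + (t ^ 2 * (l * (sin (d * t) - d * t) + A * (sin (c * t) - c * t))
      + t ^ 2 * ((\<alpha> t - A) * (sin (c * t) - c * t + c * t))))"
    by (intro is_Oh_add is_Oh_sin5) simp_all
  moreover have "\<forall>\<^sub>F t in at_right 0. (sin (c * t) - (c * t - (c * t) ^ 3 / 6))
      + (t ^ 2 * (l * (sin (d * t) - d * t) + A * (sin (c * t) - c * t))
      + t ^ 2 * ((\<alpha> t - A) * (sin (c * t) - c * t + c * t))) = (\<xi> t - 1) * (c * t)"
    using fitted
  proof eventually_elim
    case (elim t)
    have "l * d * t ^ 3 + A * c * t ^ 3 = c ^ 3 * t ^ 3 / 6"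
      using cond by (metis distrib_right times_divide_eq_left)
    then show ?case using elim by (simp add: algebra_simps eval_nat_numeral)
  qed
  ultimately show "is_Oh (1 + 4) (\<lambda>t. (\<xi> t - 1) * (c * t))"
    by simp (rule is_Oh_cong)
  show "\<forall>\<^sub>F t in at_right 0. c * t ^ 1 \<le> \<bar>c * t\<bar>"
    by (intro always_eventually allI) (simp add: abs_ge_self)
qed (fact assms)

text \<open>The value \<open>A\<close> balances the t^2 terms. At t^4 the residual \<open>K\<close>
  is left over; the equation holds exactly, so the diagonal coefficient, which is multiplied by t^2
  cos(c t), has to absorb it through - K t^2.\<close>

lemma a_expansion:
  fixes \<alpha> :: "real \<Rightarrow> real"
  assumes fitted: "\<forall>\<^sub>F t in at_right 0. t\<^sup>2 * (k + l * cos (d * t) + \<alpha> t * cos (c * t)) = 1 - cos (c * t)"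
    and cond: "k + l + A = c\<^sup>2 / 2"
    and K: "K = c ^ 4 / 24 - (l * d\<^sup>2 + A * c\<^sup>2) / 2"
  shows "is_Oh 4 (\<lambda>t. \<alpha> t - A + K * t\<^sup>2)"
proof (rule is_Oh_cancel[where m = 2])
  have "is_Oh (2 + 4) (\<lambda>t. t ^ 2 * (l * (cos (d * t) - (1 - (d * t) ^ 2 / 2))
        + A * (cos (c * t) - (1 - (c * t) ^ 2 / 2))))"
    by (intro is_Oh_mult is_Oh_power is_Oh_add is_Oh_cmult is_Oh_cos4)
  moreover have "is_Oh (4 + 2) (\<lambda>t. (K * t ^ 4) * (cos (c * t) - 1))"
    by (intro is_Oh_mult is_Oh_cmult is_Oh_power is_Oh_cos2)
  ultimately have "is_Oh 6 (\<lambda>t. - ((cos (c * t) - (1 - (c * t) ^ 2 / 2 + (c * t) ^ 4 / 24))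
      + t ^ 2 * (l * (cos (d * t) - (1 - (d * t) ^ 2 / 2))
        + A * (cos (c * t) - (1 - (c * t) ^ 2 / 2)))) + (K * t ^ 4) * (cos (c * t) - 1))"
    by (intro is_Oh_add is_Oh_minus is_Oh_cos6) simp_all
  moreover have "\<forall>\<^sub>F t in at_right 0. - ((cos (c * t) - (1 - (c * t) ^ 2 / 2 + (c * t) ^ 4 / 24))
      + t ^ 2 * (l * (cos (d * t) - (1 - (d * t) ^ 2 / 2))
        + A * (cos (c * t) - (1 - (c * t) ^ 2 / 2)))) + (K * t ^ 4) * (cos (c * t) - 1)
      = (\<alpha> t - A + K * t\<^sup>2) * (t\<^sup>2 * cos (c * t))"
    using fitted
  proof eventually_elim
    case (elim t)
    have "A = c\<^sup>2 / 2 - k - l" using cond by simp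
    then have A: "A * x = (c\<^sup>2 / 2 - k - l) * x" for x by simp
    show ?case
      using elim by (simp add: A K algebra_simps eval_nat_numeral add_divide_distrib diff_divide_distrib)
  qed
  ultimately show "is_Oh (2 + 4) (\<lambda>t. (\<alpha> t - A + K * t\<^sup>2) * (t\<^sup>2 * cos (c * t)))"
    by simp (rule is_Oh_cong)
  show "\<forall>\<^sub>F t in at_right 0. 1 / 2 * t ^ 2 \<le> \<bar>t\<^sup>2 * cos (c * t)\<bar>"
    using cos_lower_bound[of c]
  proof eventually_elim
    case (elim t)
    have "t\<^sup>2 * (1 / 2) \<le> t\<^sup>2 * cos (c * t)" by (rule mult_left_mono[OF elim]) simp
    then show ?case using abs_ge_self[of "t\<^sup>2 * cos (c * t)"] by linarith
  qed
qed simp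

lemma is_Oh_drop_quadratic:
  fixes a :: "real \<Rightarrow> real"
  assumes "is_Oh 4 (\<lambda>t. a t - A + K * t\<^sup>2)"
  shows "is_Oh 2 (\<lambda>t. a t - A)"
proof -
  have "is_Oh 2 (\<lambda>t. (a t - A + K * t\<^sup>2) - K * t ^ 2)"
    by (intro is_Oh_diff is_Oh_cmult is_Oh_power is_Oh_mono[OF assms]) simp
  then show ?thesis by simp
qed

lemma a22r_expansion: "is_Oh 4 (\<lambda>t. a22r t - A22 + K2 * t\<^sup>2)"
proof (rule a_expansion[of chi 0 0 _ c2])
  show "\<forall>\<^sub>F t in at_right 0. t\<^sup>2 * (chi + 0 * cos (0 * t) + a22r t * cos (c2 * t)) = 1 - cos (c2 * t)"
    using eventually_trig_fitted by eventually_elim (simp add: trig_fitted_stage2)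
qed (simp_all add: stage_conditions K2_def)

lemma a33r_expansion: "is_Oh 4 (\<lambda>t. a33r t - A33 + K3 * t\<^sup>2)"
proof (rule a_expansion[of beta delta c2 _ c3])
  show "\<forall>\<^sub>F t in at_right 0. t\<^sup>2 * (beta + delta * cos (c2 * t) + a33r t * cos (c3 * t)) = 1 - cos (c3 * t)"
    using eventually_trig_fitted by eventually_elim (simp add: trig_fitted_stage3)
qed (simp_all add: stage_conditions K3_def)

lemma xi2r_expansion: "is_Oh 4 (\<lambda>t. xi2r t - 1)"
proof (rule xi_expansion[OF c2_pos, of _ 0 0 a22r A22])
  show "\<forall>\<^sub>F t in at_right 0. xi2r t * c2 * t
      = sin (c2 * t) + t\<^sup>2 * (0 * sin (0 * t) + a22r t * sin (c2 * t))"
    using eventually_trig_fitted by eventually_elim (simp add: trig_fitted_stage2)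
qed (use is_Oh_drop_quadratic[OF a22r_expansion] in \<open>simp_all add: stage_conditions\<close>)

lemma xi3r_expansion: "is_Oh 4 (\<lambda>t. xi3r t - 1)"
proof (rule xi_expansion[OF c3_pos, of _ delta c2 a33r A33])
  show "\<forall>\<^sub>F t in at_right 0. xi3r t * c3 * t
      = sin (c3 * t) + t\<^sup>2 * (delta * sin (c2 * t) + a33r t * sin (c3 * t))"
    using eventually_trig_fitted by eventually_elim (simp add: trig_fitted_stage3)
qed (use is_Oh_drop_quadratic[OF a33r_expansion] in \<open>simp_all add: stage_conditions\<close>)


section \<open>Existence of the stages\<close>

text \<open>
  Brouwer's theorem gives a solution near the base point from continuity of \<open>g\<close> alone;
  uniqueness is not needed, because the error bound is proved for every branch.
\<close>

lemma implicit_stage_exists: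
  fixes g :: "'a::euclidean_space \<Rightarrow> 'a"
  assumes "open U" "y\<^sub>0 \<in> U" "continuous_on U g"
    and w: "(w \<longlongrightarrow> y\<^sub>0) (at_right 0)" and \<alpha>: "is_Oh 0 \<alpha>"
  obtains Y where "\<forall>\<^sub>F h in at_right 0. Y h = w h + h\<^sup>2 *\<^sub>R \<alpha> h *\<^sub>R g (Y h)"
    and "(Y \<longlongrightarrow> y\<^sub>0) (at_right 0)"
proof -
  obtain r where r: "r > 0" "cball y\<^sub>0 r \<subseteq> U"
    using assms(1,2) open_contains_cball by blast
  have cont: "continuous_on (cball y\<^sub>0 r) g" using assms(3) r(2) continuous_on_subset by blast
  have "bounded (g ` cball y\<^sub>0 r)"
    by (intro compact_imp_bounded compact_continuous_image cont) simp
  then obtain B where B: "B > 0" "\<And>y. y \<in> cball y\<^sub>0 r \<Longrightarrow> norm (g y) \<le> B"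
    unfolding bounded_pos by auto
  \<comment> \<open>A bound on the displacement valid on the whole ball. It serves twice:
    \<open>d h < r\<close> makes the ball invariant, and the limit 0 of \<open>d\<close> makes the
    solutions converge.\<close>
  define d where "d h = norm (w h - y\<^sub>0) + h\<^sup>2 * \<bar>\<alpha> h\<bar> * B" for h
  have "is_Oh (2 + 0) (\<lambda>h. h ^ 2 * \<alpha> h)" by (intro is_Oh_mult is_Oh_power \<alpha>)
  then have "((\<lambda>h. h\<^sup>2 * \<alpha> h) \<longlongrightarrow> 0) (at_right 0)" by (rule is_Oh_tendsto) simp
  then have "((\<lambda>h. \<bar>h\<^sup>2 * \<alpha> h\<bar> * B) \<longlongrightarrow> \<bar>0\<bar> * B) (at_right 0)" by (intro tendsto_intros)
  moreover have "((\<lambda>h. norm (w h - y\<^sub>0)) \<longlongrightarrow> norm (y\<^sub>0 - y\<^sub>0)) (at_right 0)"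
    by (intro tendsto_intros w)
  ultimately have "((\<lambda>h. norm (w h - y\<^sub>0) + \<bar>h\<^sup>2 * \<alpha> h\<bar> * B) \<longlongrightarrow> norm (y\<^sub>0 - y\<^sub>0) + \<bar>0\<bar> * B)
      (at_right 0)"
    by (intro tendsto_add)
  then have d: "(d \<longlongrightarrow> 0) (at_right 0)"
    by (simp add: d_def[abs_def] abs_mult)
  have step: "norm (w h + h\<^sup>2 *\<^sub>R \<alpha> h *\<^sub>R g y - y\<^sub>0) \<le> d h" if "y \<in> cball y\<^sub>0 r" for h y
  proof -
    have "norm (w h + h\<^sup>2 *\<^sub>R \<alpha> h *\<^sub>R g y - y\<^sub>0) \<le> norm (w h - y\<^sub>0) + norm (h\<^sup>2 *\<^sub>R \<alpha> h *\<^sub>R g y)"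
      using norm_triangle_ineq[of "w h - y\<^sub>0" "h\<^sup>2 *\<^sub>R \<alpha> h *\<^sub>R g y"] by (simp add: algebra_simps)
    moreover have "norm (h\<^sup>2 *\<^sub>R \<alpha> h *\<^sub>R g y) = (h\<^sup>2 * \<bar>\<alpha> h\<bar>) * norm (g y)"
      by (simp add: abs_mult)
    moreover have "\<dots> \<le> (h\<^sup>2 * \<bar>\<alpha> h\<bar>) * B"
      using B(2)[OF that] by (intro mult_left_mono) auto
    ultimately show ?thesis unfolding d_def by linarith
  qed
  \<comment> \<open>The fixed point is chosen separately for each h; for an h without one the value
    is arbitrary, which no eventual statement sees.\<close>
  define Y where "Y h = (SOME y. y \<in> cball y\<^sub>0 r \<and> y = w h + h\<^sup>2 *\<^sub>R \<alpha> h *\<^sub>R g y)" for h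
  have "\<forall>\<^sub>F h in at_right 0. d h < r" using d r(1) by (rule order_tendstoD)
  then have Y: "\<forall>\<^sub>F h in at_right 0. Y h \<in> cball y\<^sub>0 r \<and> Y h = w h + h\<^sup>2 *\<^sub>R \<alpha> h *\<^sub>R g (Y h)"
  proof eventually_elim
    case (elim h)
    obtain y where "y \<in> cball y\<^sub>0 r" "w h + h\<^sup>2 *\<^sub>R \<alpha> h *\<^sub>R g y = y"
    proof (rule brouwer_ball[OF r(1)])
      show "continuous_on (cball y\<^sub>0 r) (\<lambda>y. w h + h\<^sup>2 *\<^sub>R \<alpha> h *\<^sub>R g y)"
        by (intro continuous_intros cont)
      show "(\<lambda>y. w h + h\<^sup>2 *\<^sub>R \<alpha> h *\<^sub>R g y) \<in> cball y\<^sub>0 r \<rightarrow> cball y\<^sub>0 r"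
      proof (rule funcsetI)
        fix y assume "y \<in> cball y\<^sub>0 r"
        from step[OF this, of h] elim show "w h + h\<^sup>2 *\<^sub>R \<alpha> h *\<^sub>R g y \<in> cball y\<^sub>0 r"
          by (simp add: dist_norm norm_minus_commute[of y\<^sub>0])
      qed
    qed
    then have "\<exists>y. y \<in> cball y\<^sub>0 r \<and> y = w h + h\<^sup>2 *\<^sub>R \<alpha> h *\<^sub>R g y" by (intro exI[of _ y]) simp
    then show ?case unfolding Y_def by (rule someI_ex)
  qed
  show ?thesis
  proof (rule that)
    show "\<forall>\<^sub>F h in at_right 0. Y h = w h + h\<^sup>2 *\<^sub>R \<alpha> h *\<^sub>R g (Y h)"
      by (rule eventually_mono[OF Y]) (rule conjunct2)
    have "\<forall>\<^sub>F h in at_right 0. norm (Y h - y\<^sub>0) \<le> d h"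
      using Y
    proof eventually_elim
      case (elim h)
      then have "w h + h\<^sup>2 *\<^sub>R \<alpha> h *\<^sub>R g (Y h) = Y h" by (rule conjunct2[THEN sym])
      with step[OF conjunct1[OF elim], of h] show ?case by (simp only:)
    qed
    then have "((\<lambda>h. Y h - y\<^sub>0) \<longlongrightarrow> 0) (at_right 0)"
      using d by (rule Lim_null_comparison)
    then show "(Y \<longlongrightarrow> y\<^sub>0) (at_right 0)" by (simp add: LIM_zero_iff)
  qed
qed

section \<open>Linearisation near a point\<close>

lemma norm_diff_add: "norm x \<le> norm (x - y) + norm (y :: 'a::real_normed_vector)"
  using norm_triangle_ineq[of "x - y" y] by simp

text \<open>The derivative of a C^2 map is Lipschitz at \<open>y\<^sub>0\<close>. The point of
  linearisation stays fixed, and one \<open>C\<close> serves all radii \<rho>, so letting the ball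
  shrink like h gains a factor h.\<close>

lemma linearisation_bound:
  fixes g :: "'a::euclidean_space \<Rightarrow> 'a"
  assumes "open U" "y\<^sub>0 \<in> U" "C_k_on 2 g U"
  obtains r C where "r > 0" "C \<ge> 0"
    "\<And>Y Z \<rho>. \<lbrakk>Y \<in> cball y\<^sub>0 \<rho>; Z \<in> cball y\<^sub>0 \<rho>; \<rho> \<le> r\<rbrakk> \<Longrightarrow>
      norm (g Y - g Z - frechet_derivative g (at y\<^sub>0) (Y - Z)) \<le> C * \<rho> * norm (Y - Z)"
proof -
  let ?D = "\<lambda>x. frechet_derivative g (at x)"
  have g1: "C_k_on (Suc (Suc 0)) g U" using assms(3) by (simp add: numeral_2_eq_2)
  have der: "(g has_derivative ?D x) (at x)" if "x \<in> U" for x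
    using g1 that by (rule C_k_on_has_derivative)
  have lin: "bounded_linear (?D x)" if "x \<in> U" for x
    using der[OF that] has_derivative_bounded_linear by blast
  obtain r0 where r0: "r0 > 0" "cball y\<^sub>0 r0 \<subseteq> U"
    using assms(1,2) open_contains_cball by blast
  \<comment> \<open>Each derivative in a fixed direction b is differentiable at
    \<open>y\<^sub>0\<close>; its Lipschitz constant there is 1 plus a bound on that differential.
    Summing over the basis later bounds the operator norm.\<close>
  have "\<exists>L d. d > 0 \<and> L \<ge> 0 \<and> (\<forall>x. norm (x - y\<^sub>0) < d \<longrightarrow> norm (?D x b - ?D y\<^sub>0 b) \<le> L * norm (x - y\<^sub>0))" for b
  proof -
    let ?F = "\<lambda>x. ?D x b"
    have "C_k_on (Suc 0) ?F U" using g1 by (subst (asm) C_k_on.simps(2)) blast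
    then have F: "(?F has_derivative frechet_derivative ?F (at y\<^sub>0)) (at y\<^sub>0)"
      using assms(2) by (rule C_k_on_has_derivative)
    obtain K where K: "K > 0" "\<And>v. norm (frechet_derivative ?F (at y\<^sub>0) v) \<le> norm v * K"
      using bounded_linear.pos_bounded[OF has_derivative_bounded_linear[OF F]] by blast
    obtain d where d: "d > 0" "\<And>x. norm (x - y\<^sub>0) < d \<Longrightarrow>
        norm (?F x - ?F y\<^sub>0 - frechet_derivative ?F (at y\<^sub>0) (x - y\<^sub>0)) \<le> 1 * norm (x - y\<^sub>0)"
      using F unfolding has_derivative_at_alt by (meson zero_less_one)
    have "norm (?F x - ?F y\<^sub>0) \<le> (1 + K) * norm (x - y\<^sub>0)" if "norm (x - y\<^sub>0) < d" for x
    proof -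
      have "norm (?F x - ?F y\<^sub>0) \<le> norm (?F x - ?F y\<^sub>0 - frechet_derivative ?F (at y\<^sub>0) (x - y\<^sub>0))
          + norm (frechet_derivative ?F (at y\<^sub>0) (x - y\<^sub>0))"
        by (rule norm_diff_add)
      then show ?thesis using d(2)[OF that] K(2)[of "x - y\<^sub>0"] by (simp add: algebra_simps)
    qed
    then show ?thesis using d(1) K(1) by (intro exI[of _ "1 + K"] exI[of _ d]) auto
  qed
  then obtain L d where Ld: "\<And>b. d b > 0" "\<And>b. L b \<ge> 0"
    "\<And>b x. norm (x - y\<^sub>0) < d b \<Longrightarrow> norm (?D x b - ?D y\<^sub>0 b) \<le> L b * norm (x - y\<^sub>0)"
    by metis
  define C where "C = (\<Sum>b\<in>(Basis::'a set). L b)"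
  \<comment> \<open>Halving the minimum makes r < d b strict for every basis vector.\<close>
  define r where "r = min r0 (Min (d ` (Basis::'a set)) / 2)"
  have r: "r > 0" using r0 Ld(1) by (simp add: r_def)
  have C: "C \<ge> 0" unfolding C_def using Ld(2) by (rule sum_nonneg)
  have rd: "r < d b" if "b \<in> Basis" for b
  proof -
    have "Min (d ` (Basis::'a set)) \<le> d b" using that by simp
    then show ?thesis using Ld(1)[of b] by (simp add: r_def)
  qed
  have onorm: "onorm (?D x - ?D y\<^sub>0) \<le> C * \<rho>" if "x \<in> cball y\<^sub>0 \<rho>" "\<rho> \<le> r" for x \<rho>
  proof (rule onorm_le)
    fix v
    have x: "norm (x - y\<^sub>0) \<le> \<rho>" using that by (simp add: dist_norm norm_minus_commute)
    then have "x \<in> U" using that r0 by (auto simp: r_def)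
    then have l: "linear (\<lambda>v. ?D x v - ?D y\<^sub>0 v)"
      using lin assms(2) by (intro linear_compose_sub bounded_linear.linear)
    have "?D x v - ?D y\<^sub>0 v = (\<Sum>b\<in>Basis. (v \<bullet> b) *\<^sub>R (?D x b - ?D y\<^sub>0 b))"
      using linear_sum[OF l, of "\<lambda>b. (v \<bullet> b) *\<^sub>R b" Basis] linear_cmul[OF l]
      by (simp add: euclidean_representation)
    also have "norm \<dots> \<le> (\<Sum>b\<in>Basis. norm v * (L b * \<rho>))"
    proof (rule sum_norm_le)
      fix b :: 'a assume b: "b \<in> Basis"
      have "norm (x - y\<^sub>0) < d b" using x that(2) rd[OF b] by linarith
      then have "norm (?D x b - ?D y\<^sub>0 b) \<le> L b * norm (x - y\<^sub>0)" by (rule Ld(3))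
      also have "\<dots> \<le> L b * \<rho>" using x Ld(2) by (rule mult_left_mono)
      finally show "norm ((v \<bullet> b) *\<^sub>R (?D x b - ?D y\<^sub>0 b)) \<le> norm v * (L b * \<rho>)"
        using Basis_le_norm[OF b, of v] by (simp add: mult_mono)
    qed
    finally show "norm ((?D x - ?D y\<^sub>0) v) \<le> C * \<rho> * norm v"
      by (simp add: C_def sum_distrib_left sum_distrib_right mult_ac)
  qed
  show ?thesis
  proof (rule that[OF r C])
    fix Y Z \<rho> assume YZ: "Y \<in> cball y\<^sub>0 \<rho>" "Z \<in> cball y\<^sub>0 \<rho>" "\<rho> \<le> r"
    have sub: "cball y\<^sub>0 \<rho> \<subseteq> U" using YZ(3) r0(2) by (auto simp: r_def)
    have "\<rho> \<ge> 0" using YZ(1) zero_le_dist[of y\<^sub>0 Y] by (simp del: zero_le_dist)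
    have "norm (g Y - g Z - ?D y\<^sub>0 (Y - Z)) \<le> norm (Y - Z) * (C * \<rho>)"
    proof (rule differentiable_bound_linearization[where S = "cball y\<^sub>0 \<rho>" and f' = ?D])
      show "Z + t *\<^sub>R (Y - Z) \<in> cball y\<^sub>0 \<rho>" if "t \<in> {0..1}" for t
        using convexD_alt[OF convex_cball YZ(2,1), of t] that by (simp add: algebra_simps)
      show "(g has_derivative ?D x) (at x within cball y\<^sub>0 \<rho>)" if "x \<in> cball y\<^sub>0 \<rho>" for x
        using der sub that by (blast intro: has_derivative_at_withinI)
      show "onorm (?D x - ?D y\<^sub>0) \<le> C * \<rho>" if "x \<in> cball y\<^sub>0 \<rho>" for x
        using onorm that YZ(3) by blast
      show "y\<^sub>0 \<in> cball y\<^sub>0 \<rho>" using \<open>\<rho> \<ge> 0\<close> by simp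
    qed
    then show "norm (g Y - g Z - ?D y\<^sub>0 (Y - Z)) \<le> C * \<rho> * norm (Y - Z)" by (simp add: mult_ac)
  qed
qed

text \<open>Both arguments lie in a ball of radius (A + B) h, and this radius is the extra factor
  h.\<close>

lemma linearisation_is_Oh:
  fixes g :: "'a::euclidean_space \<Rightarrow> 'a"
  assumes "open U" "y\<^sub>0 \<in> U" "C_k_on 2 g U"
    and Y: "is_Oh 1 (\<lambda>h. Y h - y\<^sub>0)" and Z: "is_Oh 1 (\<lambda>h. Z h - y\<^sub>0)" and YZ: "is_Oh n (\<lambda>h. Y h - Z h)"
  shows "is_Oh (n + 1) (\<lambda>h. g (Y h) - g (Z h) - frechet_derivative g (at y\<^sub>0) (Y h - Z h))"
proof -
  obtain r C where rC: "r > 0" "C \<ge> 0"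
    "\<And>Y Z \<rho>. \<lbrakk>Y \<in> cball y\<^sub>0 \<rho>; Z \<in> cball y\<^sub>0 \<rho>; \<rho> \<le> r\<rbrakk> \<Longrightarrow>
      norm (g Y - g Z - frechet_derivative g (at y\<^sub>0) (Y - Z)) \<le> C * \<rho> * norm (Y - Z)"
    using linearisation_bound[OF assms(1-3)] by blast
  obtain A where A: "A \<ge> 0" "\<forall>\<^sub>F h in at_right 0. norm (Y h - y\<^sub>0) \<le> A * h ^ 1"
    using is_Oh_nonneg[OF Y] by blast
  obtain B where B: "B \<ge> 0" "\<forall>\<^sub>F h in at_right 0. norm (Z h - y\<^sub>0) \<le> B * h ^ 1"
    using is_Oh_nonneg[OF Z] by blast
  have "((\<lambda>h. (A + B) * h) \<longlongrightarrow> (A + B) * 0) (at_right 0)" by (intro tendsto_intros)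
  then have "\<forall>\<^sub>F h in at_right 0. (A + B) * h < r" by (rule order_tendstoD) (use rC in simp)
  then have "\<forall>\<^sub>F h in at_right 0. norm (g (Y h) - g (Z h) - frechet_derivative g (at y\<^sub>0) (Y h - Z h))
      \<le> (C * (A + B)) * norm (h ^ 1 *\<^sub>R (Y h - Z h))"
    using A(2) B(2) eventually_at_right_less[of "0::real"]
  proof eventually_elim
    case (elim h)
    have "A * h \<ge> 0" "B * h \<ge> 0" using A(1) B(1) elim(4) by auto
    then have "Y h \<in> cball y\<^sub>0 ((A + B) * h)" "Z h \<in> cball y\<^sub>0 ((A + B) * h)"
      using elim by (auto simp: dist_norm norm_minus_commute distrib_right)
    from rC(3)[OF this] show ?case using elim by (simp add: mult_ac)
  qed
  moreover have "is_Oh (n + 1) (\<lambda>h. h ^ 1 *\<^sub>R (Y h - Z h))"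
    using is_Oh_power_scaleR[OF YZ, of 1] by (simp add: add.commute)
  ultimately show ?thesis by (rule is_Oh_dominated[rotated])
qed

text \<open>A numerical branch is at first known only to converge; this bound starts the estimate of
  its error before any rate is available.\<close>

lemma lipschitz_near:
  fixes g :: "'a::euclidean_space \<Rightarrow> 'a"
  assumes "open U" "y\<^sub>0 \<in> U" "C_k_on 2 g U"
    and "(Y \<longlongrightarrow> y\<^sub>0) (at_right 0)" "(Z \<longlongrightarrow> y\<^sub>0) (at_right 0)"
  obtains L where "\<forall>\<^sub>F h in at_right 0. norm (g (Y h) - g (Z h)) \<le> L * norm (Y h - Z h)"
proof -
  obtain r C where rC: "r > 0" "C \<ge> 0"
    "\<And>Y Z \<rho>. \<lbrakk>Y \<in> cball y\<^sub>0 \<rho>; Z \<in> cball y\<^sub>0 \<rho>; \<rho> \<le> r\<rbrakk> \<Longrightarrow>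
      norm (g Y - g Z - frechet_derivative g (at y\<^sub>0) (Y - Z)) \<le> C * \<rho> * norm (Y - Z)"
    using linearisation_bound[OF assms(1-3)] by blast
  have "(g has_derivative frechet_derivative g (at y\<^sub>0)) (at y\<^sub>0)"
    using assms(2,3) by (intro C_k_on_has_derivative[of 1]) (simp_all add: numeral_2_eq_2)
  then obtain K where K: "\<And>v. norm (frechet_derivative g (at y\<^sub>0) v) \<le> norm v * K"
    using bounded_linear.pos_bounded has_derivative_bounded_linear by blast
  have "\<forall>\<^sub>F h in at_right 0. dist (Y h) y\<^sub>0 < r" "\<forall>\<^sub>F h in at_right 0. dist (Z h) y\<^sub>0 < r"
    using assms(4,5) rC(1) by (auto dest: tendstoD)
  then have "\<forall>\<^sub>F h in at_right 0. norm (g (Y h) - g (Z h)) \<le> (C * r + K) * norm (Y h - Z h)"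
  proof eventually_elim
    case (elim h)
    let ?v = "frechet_derivative g (at y\<^sub>0) (Y h - Z h)"
    have "norm (g (Y h) - g (Z h)) \<le> norm (g (Y h) - g (Z h) - ?v) + norm ?v"
      by (rule norm_diff_add)
    moreover have "norm (g (Y h) - g (Z h) - ?v) \<le> C * r * norm (Y h - Z h)"
      using elim by (intro rC(3)) (auto simp: dist_commute)
    ultimately show ?case using K[of "Y h - Z h"] unfolding distrib_right by (simp add: mult.commute)
  qed
  then show ?thesis by (rule that)
qed


section \<open>Consistency\<close>

text \<open>For small h the implicit term is at most half the norm of \<open>e\<close>, so it can be
  moved to the left and \<open>e\<close> is at most twice \<open>q\<close>. Inserting this once more
  shows that \<open>e\<close> and \<open>q\<close> differ only at order n + 2.\<close>

lemma absorb_implicit_term: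
  assumes eq: "\<forall>\<^sub>F h in at_right 0. e h = q h + h\<^sup>2 *\<^sub>R \<alpha> h *\<^sub>R G h"
    and G: "\<forall>\<^sub>F h in at_right 0. norm (G h) \<le> L * norm (e h)"
    and \<alpha>: "is_Oh 0 \<alpha>" and q: "is_Oh n q"
  shows "is_Oh n e" "is_Oh n G" "is_Oh (n + 2) (\<lambda>h. e h - q h)"
proof -
  have "is_Oh (2 + 0) (\<lambda>h. h ^ 2 * \<alpha> h)" by (intro is_Oh_mult is_Oh_power \<alpha>)
  then have "((\<lambda>h. h\<^sup>2 * \<alpha> h) \<longlongrightarrow> 0) (at_right 0)" by (rule is_Oh_tendsto) simp
  then have "((\<lambda>h. \<bar>h\<^sup>2 * \<alpha> h\<bar> * L) \<longlongrightarrow> \<bar>0\<bar> * L) (at_right 0)" by (intro tendsto_intros)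
  then have "\<forall>\<^sub>F h in at_right 0. \<bar>h\<^sup>2 * \<alpha> h\<bar> * L < 1 / 2" by (rule order_tendstoD) simp
  with eq G have "\<forall>\<^sub>F h in at_right 0. norm (e h) \<le> 2 * norm (q h)"
  proof eventually_elim
    case (elim h)
    have "norm (e h) \<le> norm (q h) + norm (h\<^sup>2 *\<^sub>R \<alpha> h *\<^sub>R G h)"
      by (subst elim(1)) (rule norm_triangle_ineq)
    also have "norm (h\<^sup>2 *\<^sub>R \<alpha> h *\<^sub>R G h) = \<bar>h\<^sup>2 * \<alpha> h\<bar> * norm (G h)" by (simp add: abs_mult)
    also have "\<dots> \<le> \<bar>h\<^sup>2 * \<alpha> h\<bar> * (L * norm (e h))"
      using elim(2) by (intro mult_left_mono) auto
    also have "\<dots> = (\<bar>h\<^sup>2 * \<alpha> h\<bar> * L) * norm (e h)" by simp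
    also have "\<dots> \<le> 1 / 2 * norm (e h)"
      using elim(3) by (intro mult_right_mono) auto
    finally show ?case by simp
  qed
  then show e: "is_Oh n e" by (rule is_Oh_dominated[OF q])
  then show vG: "is_Oh n G" using G by (rule is_Oh_dominated)
  have "is_Oh (2 + (0 + n)) (\<lambda>h. h ^ 2 *\<^sub>R \<alpha> h *\<^sub>R G h)"
    by (intro is_Oh_scaleR is_Oh_power \<alpha> vG)
  then show "is_Oh (n + 2) (\<lambda>h. e h - q h)"
  proof (rule is_Oh_cong[of "n + 2", OF back_subst[of "\<lambda>k. is_Oh k _"]])
    show "\<forall>\<^sub>F h in at_right 0. h\<^sup>2 *\<^sub>R \<alpha> h *\<^sub>R G h = e h - q h"
      using eq by eventually_elim (metis add_diff_cancel_left')
  qed simp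
qed

section \<open>The stage and update equations with real coefficients\<close>

lemma stage_eqs_ef_method:
  "stage_eqs ef_method \<omega> f y\<^sub>0 h Y \<longleftrightarrow>
    Y 1 = y\<^sub>0 \<and>
    Y 2 = y\<^sub>0 + (xi2r (\<omega> * h) * c2 * h) *\<^sub>R f y\<^sub>0
      + h\<^sup>2 *\<^sub>R (chi *\<^sub>R gder f (Y 1) + a22r (\<omega> * h) *\<^sub>R gder f (Y 2)) \<and>
    Y 3 = y\<^sub>0 + (xi3r (\<omega> * h) * c3 * h) *\<^sub>R f y\<^sub>0
      + h\<^sup>2 *\<^sub>R (beta *\<^sub>R gder f (Y 1) + delta *\<^sub>R gder f (Y 2) + a33r (\<omega> * h) *\<^sub>R gder f (Y 3))"
  unfolding stage_eqs_def Let_def real_coefficients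
  by (simp add: stages a22r_def a33r_def xi2r_def xi3r_def add.assoc)

lemma step_ef_method:
  "step ef_method \<omega> f y\<^sub>0 h Y = y\<^sub>0 + h *\<^sub>R f y\<^sub>0
    + h\<^sup>2 *\<^sub>R (b1r (\<omega> * h) *\<^sub>R gder f (Y 1) + eta *\<^sub>R gder f (Y 2) + b3r (\<omega> * h) *\<^sub>R gder f (Y 3))"
  unfolding step_def Let_def
  by (simp add: stages b1r_def b3r_def add.assoc)

lemma gder_eq_lie: "gder f = lie f f"
  by (simp add: fun_eq_iff gder_def lie_def)

section \<open>Derivatives of the exact solution and its defects in the method\<close>

context
  fixes f :: "'a::euclidean_space \<Rightarrow> 'a" and U :: "'a set" and y :: "real \<Rightarrow> 'a" and a T \<omega> :: real
  assumes U: "open U" and f: "C_k_on 6 f U" and T: "T > 0" and \<omega>: "\<omega> > 0"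
    and y: "\<And>x. x \<in> {a..a + T} \<Longrightarrow> y x \<in> U"
    and ode: "\<And>x. x \<in> {a..a + T} \<Longrightarrow> (y has_vector_derivative f (y x)) (at x within {a..a + T})"
begin

text \<open>The n-th derivative of the solution, read off from the differential equation. The count
  is shifted by one: index n uses n - 1 Lie derivatives of \<open>f\<close>, so class C^6 gives
  indices up to 7.\<close>

definition yder :: "nat \<Rightarrow> real \<Rightarrow> 'a" where
  "yder n t = (case n of 0 \<Rightarrow> y t | Suc j \<Rightarrow> (lie f ^^ j) f (y t))"

lemma yder_simps: "yder 0 t = y t" "yder 1 t = f (y t)" "yder 2 t = gder f (y t)"
  by (simp_all add: yder_def gder_eq_lie numeral_2_eq_2)

lemma yder_derivative:
  assumes "m < 7" "t \<in> {a..a + T}"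
  shows "(yder m has_vector_derivative yder (Suc m) t) (at t within {a..a + T})"
proof (cases m)
  case 0
  then show ?thesis using ode[OF assms(2)] by (simp add: yder_def[abs_def])
next
  case (Suc j)
  have "C_k_on (6 - j) ((lie f ^^ j) f) U"
    using U f Suc assms by (intro C_k_on_lie_iterate) auto
  then have "C_k_on (Suc (5 - j)) ((lie f ^^ j) f) U"
    using Suc assms by (simp add: Suc_diff_le[symmetric] del: C_k_on.simps)
  from solution_lie_derivative[where f = f and y = y, OF this y[OF assms(2)] ode[OF assms(2)]]
  show ?thesis by (simp add: Suc yder_def[abs_def])
qed

lemma yder_continuous:
  assumes "m \<le> 7"
  shows "continuous_on {a..a + T} (yder m)"
proof (cases "m = 7")
  case True
  have "C_k_on (6 - 6) ((lie f ^^ 6) f) U"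
    using U f by (intro C_k_on_lie_iterate) auto
  then have "continuous_on U ((lie f ^^ 6) f)" by simp
  moreover have "continuous_on {a..a + T} y"
    using ode by (rule continuous_on_vector_derivative)
  ultimately have "continuous_on {a..a + T} (\<lambda>t. (lie f ^^ 6) f (y t))"
    using y by (auto intro: continuous_on_compose2)
  moreover have "yder 7 = (\<lambda>t. (lie f ^^ 6) f (y t))"
    by (simp add: yder_def fun_eq_iff eval_nat_numeral)
  ultimately show ?thesis using True by simp
next
  case False
  show ?thesis
    by (rule continuous_on_vector_derivative[OF yder_derivative]) (use assms False in auto)
qed

lemma solution_taylor:
  assumes "c \<ge> 0" "0 < p" "p \<le> 7"
  shows "is_Oh p (\<lambda>h. y (a + c * h) - (\<Sum>i<p. ((c * h) ^ i / fact i) *\<^sub>R yder i a))"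
  using taylor_is_Oh[OF T assms(1,2), where D = yder and a = a] assms yder_derivative yder_continuous
  by (simp add: yder_simps)

text \<open>Along the solution \<open>gder f\<close> is y'', so two of the seven derivatives are
  already spent.\<close>

lemma gder_taylor:
  assumes "c \<ge> 0" "0 < p" "p \<le> 5"
  shows "is_Oh p (\<lambda>h. gder f (y (a + c * h)) - (\<Sum>i<p. ((c * h) ^ i / fact i) *\<^sub>R yder (i + 2) a))"
  using taylor_is_Oh[OF T assms(1,2), where D = "\<lambda>i. yder (i + 2)" and a = a]
    assms yder_derivative[of "_ + 2"] yder_continuous[of "p + 2"]
  by (simp add: yder_simps del: add_2_eq_Suc')

lemma ya: "y a \<in> U" using y T by simp

lemma C2_gder: "C_k_on 2 (gder f) U"
proof -
  have "C_k_on (6 - 1) ((lie f ^^ 1) f) U" using U f by (rule C_k_on_lie_iterate) simp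
  then have "C_k_on 5 (gder f) U" by (simp add: gder_eq_lie)
  then show ?thesis by (rule C_k_on_mono) simp
qed

lemma bounded_coefficient:
  fixes q :: "real \<Rightarrow> real"
  assumes "is_Oh 4 (\<lambda>t. q t - A + K * t\<^sup>2)"
  shows "is_Oh 0 (\<lambda>h. q (\<omega> * h))"
proof -
  have "is_Oh 0 (\<lambda>t. q t - A + A)"
    using is_Oh_mono[OF is_Oh_drop_quadratic[OF assms], of 0] by (intro is_Oh_add is_Oh_const) simp
  then have "is_Oh 0 q" by simp
  then show ?thesis by (rule is_Oh_compose_scale[OF _ \<omega>])
qed

text \<open>The terms through h^3 cancel by \<open>cond\<close>. At h^4 two contributions meet: the
  residual \<open>K\<close> times y'''', and the shift - K (\<omega> h)^2 of the coefficient
  \<alpha> in front of h^2 y''.\<close>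

lemma stage_defect:
  fixes \<xi> \<alpha> :: "real \<Rightarrow> real"
  assumes "c \<ge> 0" "d \<ge> 0"
    and \<xi>: "is_Oh 4 (\<lambda>t. \<xi> t - 1)" and \<alpha>: "is_Oh 4 (\<lambda>t. \<alpha> t - A + K * t\<^sup>2)"
    and cond: "k + l + A = c\<^sup>2 / 2" "l * d + A * c = c ^ 3 / 6"
      "K = c ^ 4 / 24 - (l * d\<^sup>2 + A * c\<^sup>2) / 2"
  defines "def \<equiv> \<lambda>h. y (a + c * h) - y a - (\<xi> (\<omega> * h) * c * h) *\<^sub>R f (y a)
    - h\<^sup>2 *\<^sub>R (k *\<^sub>R gder f (y a) + l *\<^sub>R gder f (y (a + d * h))
        + \<alpha> (\<omega> * h) *\<^sub>R gder f (y (a + c * h)))"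
  shows "is_Oh 5 (\<lambda>h. def h - (h ^ 4 * K) *\<^sub>R (yder 4 a + \<omega>\<^sup>2 *\<^sub>R yder 2 a))"
proof -
  define E where "E h = y (a + c * h) - (\<Sum>i<5. ((c * h) ^ i / fact i) *\<^sub>R yder i a)" for h
  define G where "G c h = gder f (y (a + c * h)) - (\<Sum>i<3. ((c * h) ^ i / fact i) *\<^sub>R yder (i + 2) a)"
    for c h
  have E: "is_Oh 5 E" unfolding E_def using assms(1) by (intro solution_taylor) auto
  have G: "is_Oh 3 (G c)" "is_Oh 3 (G d)" unfolding G_def using assms(1,2) by (intro gder_taylor; simp)+
  define x where "x h = \<xi> (\<omega> * h) - 1" for h
  \<comment> \<open>The same coefficient at two accuracies: in front of h^2 y'' its expansion up to
    O(h^4) is used, in front of h^3 y''' and h^4 y'''' the crude O(h^2) suffices.\<close>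
  define \<epsilon> where "\<epsilon> h = \<alpha> (\<omega> * h) - A + K * (\<omega> * h)\<^sup>2" for h
  define r where "r h = \<alpha> (\<omega> * h) - A" for h
  have x: "is_Oh 4 x" unfolding x_def by (rule is_Oh_compose_scale[OF \<xi> \<omega>])
  have \<epsilon>: "is_Oh 4 \<epsilon>" unfolding \<epsilon>_def by (rule is_Oh_compose_scale[OF \<alpha> \<omega>])
  have r: "is_Oh 2 r" unfolding r_def by (rule is_Oh_compose_scale[OF is_Oh_drop_quadratic[OF \<alpha>] \<omega>])
  have al: "is_Oh 0 (\<lambda>h. r h + A)" by (intro is_Oh_add is_Oh_mono[OF r] is_Oh_const) simp
  have 1: "is_Oh (4 + 1) (\<lambda>h. (x h * (c * h ^ 1)) *\<^sub>R yder 1 a)"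
    by (intro is_Oh_scaleR_const is_Oh_mult x is_Oh_cmult is_Oh_power)
  have 2: "is_Oh (2 + 3) (\<lambda>h. h ^ 2 *\<^sub>R (l *\<^sub>R G d h + (r h + A) *\<^sub>R G c h))"
    using is_Oh_scaleR[OF al G(1)] by (intro is_Oh_power_scaleR is_Oh_add is_Oh_cscaleR G) simp
  have 3: "is_Oh (2 + 4) (\<lambda>h. (h ^ 2 * \<epsilon> h) *\<^sub>R yder 2 a)"
    by (intro is_Oh_scaleR_const is_Oh_mult is_Oh_power \<epsilon>)
  have 4: "is_Oh (3 + 2) (\<lambda>h. (h ^ 3 * (c * r h)) *\<^sub>R yder 3 a)"
    by (intro is_Oh_scaleR_const is_Oh_mult is_Oh_power is_Oh_cmult r)
  have 5: "is_Oh (4 + 2) (\<lambda>h. (h ^ 4 * (c\<^sup>2 / 2 * r h)) *\<^sub>R yder 4 a)"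
    by (intro is_Oh_scaleR_const is_Oh_mult is_Oh_power is_Oh_cmult r)
  have "is_Oh 5 (\<lambda>h. E h - (x h * (c * h ^ 1)) *\<^sub>R yder 1 a
      - h ^ 2 *\<^sub>R (l *\<^sub>R G d h + (r h + A) *\<^sub>R G c h) - (h ^ 2 * \<epsilon> h) *\<^sub>R yder 2 a
      - (h ^ 3 * (c * r h)) *\<^sub>R yder 3 a - (h ^ 4 * (c\<^sup>2 / 2 * r h)) *\<^sub>R yder 4 a)"
    using 1 2 is_Oh_mono[OF 3, of 5] 4 is_Oh_mono[OF 5, of 5] by (intro is_Oh_diff E) simp_all
  moreover have "def h - (h ^ 4 * K) *\<^sub>R (yder 4 a + \<omega>\<^sup>2 *\<^sub>R yder 2 a)
    = E h - (x h * (c * h ^ 1)) *\<^sub>R yder 1 a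
      - h ^ 2 *\<^sub>R (l *\<^sub>R G d h + (r h + A) *\<^sub>R G c h) - (h ^ 2 * \<epsilon> h) *\<^sub>R yder 2 a
      - (h ^ 3 * (c * r h)) *\<^sub>R yder 3 a - (h ^ 4 * (c\<^sup>2 / 2 * r h)) *\<^sub>R yder 4 a" (is "?L = ?R") for h
  proof -
    \<comment> \<open>The three added terms are zero by \<open>cond\<close>; with them the equation
      is an identity free of side conditions, to be checked componentwise.\<close>
    have "?L = ?R + (h\<^sup>2 * (c\<^sup>2 / 2 - (k + l + A))) *\<^sub>R yder 2 a
        + (h ^ 3 * (c ^ 3 / 6 - (l * d + A * c))) *\<^sub>R yder 3 a
        + (h ^ 4 * (c ^ 4 / 24 - (l * d\<^sup>2 + A * c\<^sup>2) / 2 - K)) *\<^sub>R yder 4 a"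
    proof (rule euclidean_eqI)
      fix b :: 'a
      have sums: "{..<5} = {0, 1, 2, 3, 4::nat}" "{..<3} = {0, 1, 2::nat}" by auto
      show "?L \<bullet> b = (?R + (h\<^sup>2 * (c\<^sup>2 / 2 - (k + l + A))) *\<^sub>R yder 2 a
        + (h ^ 3 * (c ^ 3 / 6 - (l * d + A * c))) *\<^sub>R yder 3 a
        + (h ^ 4 * (c ^ 4 / 24 - (l * d\<^sup>2 + A * c\<^sup>2) / 2 - K)) *\<^sub>R yder 4 a) \<bullet> b"
        unfolding def_def E_def G_def x_def \<epsilon>_def r_def sums
        by (simp add: inner_simps fact_numeral yder_simps del: One_nat_def add_2_eq_Suc add_2_eq_Suc')
           (simp add: field_simps eval_nat_numeral)
    qed
    then show ?thesis by (simp add: cond)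
  qed
  ultimately show ?thesis by simp
qed

text \<open>In the Taylor expansion \<open>b1\<close> multiplies y'' only and is covered by the sum
  \<sigma>; the deviation of \<open>b3\<close> then first appears with h^3, where O(h^4) is
  enough.\<close>

lemma quadrature_defect:
  "is_Oh 7 (\<lambda>h. y (a + h) - y a - h *\<^sub>R f (y a) - h\<^sup>2 *\<^sub>R (b1r (\<omega> * h) *\<^sub>R gder f (y a)
    + eta *\<^sub>R gder f (y (a + c2 * h)) + b3r (\<omega> * h) *\<^sub>R gder f (y (a + c3 * h))))"
    (is "is_Oh 7 ?R")
proof -
  define E where "E h = y (a + h) - (\<Sum>i<7. (h ^ i / fact i) *\<^sub>R yder i a)" for h
  define G where "G c h = gder f (y (a + c * h)) - (\<Sum>i<5. ((c * h) ^ i / fact i) *\<^sub>R yder (i + 2) a)"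
    for c h
  have E: "is_Oh 7 E" unfolding E_def using solution_taylor[of 1 7] by simp
  have G: "is_Oh 5 (G c2)" "is_Oh 5 (G c3)"
    unfolding G_def using c2_pos c3_pos by (intro gder_taylor; simp)+
  define \<sigma> where "\<sigma> h = b1r (\<omega> * h) + eta + b3r (\<omega> * h) - 1 / 2" for h
  define r where "r h = b3r (\<omega> * h) - B3" for h
  have \<sigma>: "is_Oh 5 \<sigma>" unfolding \<sigma>_def by (rule is_Oh_compose_scale[OF b1r_expansion(1) \<omega>])
  have r: "is_Oh 4 r" unfolding r_def by (rule is_Oh_compose_scale[OF b3r_expansion \<omega>])
  have b3: "is_Oh 0 (\<lambda>h. r h + B3)" by (intro is_Oh_add is_Oh_mono[OF r] is_Oh_const) simp
  have 1: "is_Oh (2 + 5) (\<lambda>h. h ^ 2 *\<^sub>R (eta *\<^sub>R G c2 h + (r h + B3) *\<^sub>R G c3 h))"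
    using is_Oh_scaleR[OF b3 G(2)] by (intro is_Oh_power_scaleR is_Oh_add is_Oh_cscaleR G) simp
  have 2: "is_Oh (2 + 5) (\<lambda>h. (h ^ 2 * \<sigma> h) *\<^sub>R yder 2 a)"
    by (intro is_Oh_scaleR_const is_Oh_mult is_Oh_power \<sigma>)
  have 3: "is_Oh (n + 4) (\<lambda>h. (h ^ n * (q * r h)) *\<^sub>R v)" for n q and v :: 'a
    by (intro is_Oh_scaleR_const is_Oh_mult is_Oh_power is_Oh_cmult r)
  have 4: "is_Oh 7 (\<lambda>h. (h ^ n * (q * r h)) *\<^sub>R v)" if "n \<ge> 3" for n q and v :: 'a
    using that by (intro is_Oh_mono[OF 3]) simp
  have "is_Oh 7 (\<lambda>h. E h - h ^ 2 *\<^sub>R (eta *\<^sub>R G c2 h + (r h + B3) *\<^sub>R G c3 h)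
      - (h ^ 2 * \<sigma> h) *\<^sub>R yder 2 a - (h ^ 3 * (c3 * r h)) *\<^sub>R yder 3 a
      - (h ^ 4 * (c3\<^sup>2 / 2 * r h)) *\<^sub>R yder 4 a - (h ^ 5 * (c3 ^ 3 / 6 * r h)) *\<^sub>R yder 5 a
      - (h ^ 6 * (c3 ^ 4 / 24 * r h)) *\<^sub>R yder 6 a)"
    using 1 2 by (intro is_Oh_diff E 4) simp_all
  moreover have "?R h = E h - h ^ 2 *\<^sub>R (eta *\<^sub>R G c2 h + (r h + B3) *\<^sub>R G c3 h)
      - (h ^ 2 * \<sigma> h) *\<^sub>R yder 2 a - (h ^ 3 * (c3 * r h)) *\<^sub>R yder 3 a
      - (h ^ 4 * (c3\<^sup>2 / 2 * r h)) *\<^sub>R yder 4 a - (h ^ 5 * (c3 ^ 3 / 6 * r h)) *\<^sub>R yder 5 a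
      - (h ^ 6 * (c3 ^ 4 / 24 * r h)) *\<^sub>R yder 6 a" (is "_ = ?Q") for h
  proof -
    \<comment> \<open>The added terms are the quadrature errors on s, ..., s^4, all zero; as in
      \<open>stage_defect\<close> they free the identity from side conditions.\<close>
    have "?R h = ?Q + (h ^ 3 * (1 / 6 - (eta * c2 + B3 * c3))) *\<^sub>R yder 3 a
        + (h ^ 4 / 2 * (1 / 12 - (eta * c2\<^sup>2 + B3 * c3\<^sup>2))) *\<^sub>R yder 4 a
        + (h ^ 5 / 6 * (1 / 20 - (eta * c2 ^ 3 + B3 * c3 ^ 3))) *\<^sub>R yder 5 a
        + (h ^ 6 / 24 * (1 / 30 - (eta * c2 ^ 4 + B3 * c3 ^ 4))) *\<^sub>R yder 6 a" (is "_ = ?Q'")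
    proof (rule euclidean_eqI)
      fix b :: 'a
      have sums: "{..<7} = {0, 1, 2, 3, 4, 5, 6::nat}" "{..<5} = {0, 1, 2, 3, 4::nat}" by auto
      show "?R h \<bullet> b = ?Q' \<bullet> b"
        unfolding E_def G_def \<sigma>_def r_def sums
        by (simp add: inner_simps fact_numeral yder_simps del: One_nat_def add_2_eq_Suc add_2_eq_Suc')
           (simp add: field_simps eval_nat_numeral)
    qed
    then show ?thesis by (simp add: quadrature_conditions)
  qed
  ultimately show ?thesis by simp
qed

text \<open>The method is diagonally implicit: each stage has only itself as unknown, so stage 2 is
  solved first and then enters the explicit part \<open>w3\<close> of stage 3.\<close>

lemma stage_branch_exists: "\<exists>Y. stage_branch ef_method \<omega> f (y a) Y"
proof -
  have cont: "continuous_on U (gder f)" using C2_gder by (rule C_k_on_imp_continuous)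
  have g: "((\<lambda>h. gder f (Y h)) \<longlongrightarrow> gder f (y a)) (at_right 0)"
    if "(Y \<longlongrightarrow> y a) (at_right 0)" for Y :: "real \<Rightarrow> 'a"
    using cont U ya that by (metis continuous_on_eq_continuous_at isCont_tendsto_compose)
  have scale: "((\<lambda>h. q (\<omega> * h)) \<longlongrightarrow> l) (at_right 0)" if "is_Oh 4 (\<lambda>t. q t - l)" for q :: "real \<Rightarrow> real" and l
    using is_Oh_tendsto[OF is_Oh_compose_scale[OF that \<omega>]] by (simp add: LIM_zero_iff)
  define w2 where "w2 h = y a + (xi2r (\<omega> * h) * c2 * h) *\<^sub>R f (y a) + h\<^sup>2 *\<^sub>R chi *\<^sub>R gder f (y a)" for h
  have "(w2 \<longlongrightarrow> y a + (1 * c2 * 0) *\<^sub>R f (y a) + 0\<^sup>2 *\<^sub>R chi *\<^sub>R gder f (y a)) (at_right 0)"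
    unfolding w2_def by (intro tendsto_intros scale xi2r_expansion)
  then have w2: "(w2 \<longlongrightarrow> y a) (at_right 0)" by simp
  obtain Y2 where Y2: "\<forall>\<^sub>F h in at_right 0. Y2 h = w2 h + h\<^sup>2 *\<^sub>R a22r (\<omega> * h) *\<^sub>R gder f (Y2 h)"
    "(Y2 \<longlongrightarrow> y a) (at_right 0)"
    using implicit_stage_exists[OF U ya cont w2 bounded_coefficient[OF a22r_expansion]] by blast
  define w3 where "w3 h = y a + (xi3r (\<omega> * h) * c3 * h) *\<^sub>R f (y a)
    + h\<^sup>2 *\<^sub>R (beta *\<^sub>R gder f (y a) + delta *\<^sub>R gder f (Y2 h))" for h
  have "(w3 \<longlongrightarrow> y a + (1 * c3 * 0) *\<^sub>R f (y a)
      + 0\<^sup>2 *\<^sub>R (beta *\<^sub>R gder f (y a) + delta *\<^sub>R gder f (y a))) (at_right 0)"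
    unfolding w3_def by (intro tendsto_intros scale xi3r_expansion g Y2)
  then have w3: "(w3 \<longlongrightarrow> y a) (at_right 0)" by simp
  obtain Y3 where Y3: "\<forall>\<^sub>F h in at_right 0. Y3 h = w3 h + h\<^sup>2 *\<^sub>R a33r (\<omega> * h) *\<^sub>R gder f (Y3 h)"
    "(Y3 \<longlongrightarrow> y a) (at_right 0)"
    using implicit_stage_exists[OF U ya cont w3 bounded_coefficient[OF a33r_expansion]] by blast
  define Y where "Y h = (\<lambda>_::nat. y a)(2 := Y2 h, 3 := Y3 h)" for h
  have Y: "Y h 1 = y a" "Y h 2 = Y2 h" "Y h 3 = Y3 h" for h by (simp_all add: Y_def)
  have "stage_branch ef_method \<omega> f (y a) Y"
    unfolding stage_branch_def
  proof (intro conjI ballI)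
    show "\<forall>\<^sub>F h in at_right 0. stage_eqs ef_method \<omega> f (y a) h (Y h)"
      using Y2(1) Y3(1)
    proof eventually_elim
      case (elim h)
      show ?case
        unfolding stage_eqs_ef_method Y
      proof (intro conjI refl)
        show "Y2 h = y a + (xi2r (\<omega> * h) * c2 * h) *\<^sub>R f (y a)
            + h\<^sup>2 *\<^sub>R (chi *\<^sub>R gder f (y a) + a22r (\<omega> * h) *\<^sub>R gder f (Y2 h))"
          by (rule trans[OF elim(1)]) (simp add: w2_def scaleR_add_right)
        show "Y3 h = y a + (xi3r (\<omega> * h) * c3 * h) *\<^sub>R f (y a) + h\<^sup>2 *\<^sub>R (beta *\<^sub>R gder f (y a)
            + delta *\<^sub>R gder f (Y2 h) + a33r (\<omega> * h) *\<^sub>R gder f (Y3 h))"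
          by (rule trans[OF elim(2)]) (simp add: w3_def scaleR_add_right)
      qed
    qed
    fix i :: nat assume "i \<in> {1..3}"
    then show "((\<lambda>h. Y h i) \<longlongrightarrow> y a) (at_right 0)"
      using Y Y2(2) Y3(2) by (auto simp: stages)
  qed
  then show ?thesis by blast
qed

lemma stage_branch_error:
  assumes "stage_branch ef_method \<omega> f (y a) Y"
  shows "is_Oh 7 (\<lambda>h. y (a + h) - step ef_method \<omega> f (y a) h (Y h))"
proof -
  define g where "g = gder f"
  \<comment> \<open>the differential operator in \<open>V\<close> annihilates $e^{\pm\mathrm{i}\omega x}$, as fitting requires\<close>
  define V where "V = yder 4 a + \<omega>\<^sup>2 *\<^sub>R yder 2 a"
  define Z where "Z c h = y (a + c * h)" for c h
  define \<alpha>2 \<alpha>3 where "\<alpha>2 h = a22r (\<omega> * h)" and "\<alpha>3 h = a33r (\<omega> * h)" for h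
  define e2 e3 where "e2 h = Y h 2 - Z c2 h" and "e3 h = Y h 3 - Z c3 h" for h
  define d2 where "d2 h = Z c2 h - y a - (xi2r (\<omega> * h) * c2 * h) *\<^sub>R f (y a)
    - h\<^sup>2 *\<^sub>R (chi *\<^sub>R g (y a) + \<alpha>2 h *\<^sub>R g (Z c2 h))" for h
  define d3 where "d3 h = Z c3 h - y a - (xi3r (\<omega> * h) * c3 * h) *\<^sub>R f (y a)
    - h\<^sup>2 *\<^sub>R (beta *\<^sub>R g (y a) + delta *\<^sub>R g (Z c2 h) + \<alpha>3 h *\<^sub>R g (Z c3 h))" for h
  define G2 G3 where "G2 h = g (Y h 2) - g (Z c2 h)" and "G3 h = g (Y h 3) - g (Z c3 h)" for h
  define R where "R h = y (a + h) - y a - h *\<^sub>R f (y a) - h\<^sup>2 *\<^sub>R (b1r (\<omega> * h) *\<^sub>R g (y a)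
    + eta *\<^sub>R g (Z c2 h) + b3r (\<omega> * h) *\<^sub>R g (Z c3 h))" for h
  have g: "C_k_on 2 g U" unfolding g_def by (rule C2_gder)
  have Y: "((\<lambda>h. Y h 2) \<longlongrightarrow> y a) (at_right 0)" "((\<lambda>h. Y h 3) \<longlongrightarrow> y a) (at_right 0)"
    using assms by (auto simp: stage_branch_def)
  have eqs: "\<forall>\<^sub>F h in at_right 0. stage_eqs ef_method \<omega> f (y a) h (Y h)"
    using assms by (simp add: stage_branch_def)
  have Z1: "is_Oh 1 (\<lambda>h. Z c h - y a)" if "c \<ge> 0" for c
    using solution_taylor[OF that, of 1] by (simp add: Z_def yder_simps)
  have Z: "(Z c \<longlongrightarrow> y a) (at_right 0)" if "c \<ge> 0" for c
    using is_Oh_tendsto[OF Z1[OF that]] by (simp add: LIM_zero_iff)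
  have c: "c2 \<ge> 0" "c3 \<ge> 0" using c2_pos c3_pos by auto
  have \<alpha>: "is_Oh 0 \<alpha>2" "is_Oh 0 \<alpha>3"
    unfolding \<alpha>2_def \<alpha>3_def by (rule bounded_coefficient, rule a22r_expansion a33r_expansion)+
  have d2: "is_Oh 5 (\<lambda>h. d2 h - (h ^ 4 * K2) *\<^sub>R V)"
    using stage_defect[OF c(1) order_refl xi2r_expansion a22r_expansion, of chi 0]
    by (simp add: stage_conditions K2_def V_def d2_def Z_def \<alpha>2_def g_def)
  have d3: "is_Oh 5 (\<lambda>h. d3 h - (h ^ 4 * K3) *\<^sub>R V)"
    using stage_defect[OF c(2,1) xi3r_expansion a33r_expansion, of beta delta]
    by (simp add: stage_conditions K3_def V_def d3_def Z_def \<alpha>3_def g_def)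
  have h4: "is_Oh 4 (\<lambda>h. (h ^ 4 * K) *\<^sub>R V)" for K
    using is_Oh_scaleR_const[OF is_Oh_cmult[OF is_Oh_power[of 4], of K], of V] by (simp add: mult.commute)
  have "is_Oh 4 (\<lambda>h. (d2 h - (h ^ 4 * K2) *\<^sub>R V) + (h ^ 4 * K2) *\<^sub>R V)"
    by (intro is_Oh_add h4 is_Oh_mono[OF d2]) simp
  then have d2': "is_Oh 4 (\<lambda>h. - d2 h)" by (simp add: is_Oh_minus)
  have "is_Oh 4 (\<lambda>h. (d3 h - (h ^ 4 * K3) *\<^sub>R V) + (h ^ 4 * K3) *\<^sub>R V)"
    by (intro is_Oh_add h4 is_Oh_mono[OF d3]) simp
  then have d3': "is_Oh 4 (\<lambda>h. - d3 h)" by (simp add: is_Oh_minus)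
  obtain L2 where L2: "\<forall>\<^sub>F h in at_right 0. norm (G2 h) \<le> L2 * norm (e2 h)"
    unfolding G2_def e2_def using lipschitz_near[OF U ya g Y(1) Z[OF c(1)]] by blast
  obtain L3 where L3: "\<forall>\<^sub>F h in at_right 0. norm (G3 h) \<le> L3 * norm (e3 h)"
    unfolding G3_def e3_def using lipschitz_near[OF U ya g Y(2) Z[OF c(2)]] by blast
  \<comment> \<open>The stage equation minus the same equation for the exact solution, which holds
    up to \<open>d2\<close>. Stage 1 is exact, so the terms with \<open>chi\<close> cancel.\<close>
  have "\<forall>\<^sub>F h in at_right 0. e2 h = - d2 h + h\<^sup>2 *\<^sub>R \<alpha>2 h *\<^sub>R G2 h"
    using eqs
  proof eventually_elim
    case (elim h)
    have "Y h 1 = y a" and *: "Y h 2 = y a + (xi2r (\<omega> * h) * c2 * h) *\<^sub>R f (y a)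
      + h\<^sup>2 *\<^sub>R (chi *\<^sub>R g (Y h 1) + \<alpha>2 h *\<^sub>R g (Y h 2))"
      using elim unfolding stage_eqs_ef_method g_def \<alpha>2_def by blast+
    then show ?case
      by (subst e2_def, subst *) (simp add: d2_def G2_def algebra_simps)
  qed
  from absorb_implicit_term[OF this L2 \<alpha>(1) d2']
  have e2: "is_Oh 4 e2" "is_Oh 4 G2" "is_Oh 6 (\<lambda>h. e2 h - - d2 h)" by simp_all
  \<comment> \<open>The error of stage 2 reaches stage 3 only at O(h^6) and leaves its h^4 term
    untouched.\<close>
  have "is_Oh (2 + 4) (\<lambda>h. h ^ 2 *\<^sub>R delta *\<^sub>R G2 h)" by (intro is_Oh_power_scaleR is_Oh_cscaleR e2)
  then have dG2: "is_Oh 6 (\<lambda>h. h\<^sup>2 *\<^sub>R delta *\<^sub>R G2 h)" by simp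
  have "is_Oh 4 (\<lambda>h. - d3 h + h\<^sup>2 *\<^sub>R delta *\<^sub>R G2 h)"
    by (intro is_Oh_add d3' is_Oh_mono[OF dG2]) simp
  moreover have "\<forall>\<^sub>F h in at_right 0. e3 h = (- d3 h + h\<^sup>2 *\<^sub>R delta *\<^sub>R G2 h) + h\<^sup>2 *\<^sub>R \<alpha>3 h *\<^sub>R G3 h"
    using eqs
  proof eventually_elim
    case (elim h)
    have "Y h 1 = y a" and *: "Y h 3 = y a + (xi3r (\<omega> * h) * c3 * h) *\<^sub>R f (y a)
      + h\<^sup>2 *\<^sub>R (beta *\<^sub>R g (Y h 1) + delta *\<^sub>R g (Y h 2) + \<alpha>3 h *\<^sub>R g (Y h 3))"
      using elim unfolding stage_eqs_ef_method g_def \<alpha>3_def by blast+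
    then show ?case
      by (subst e3_def, subst *) (simp add: d3_def G2_def G3_def algebra_simps)
  qed
  ultimately have e3: "is_Oh 4 e3" "is_Oh 4 G3" "is_Oh 6 (\<lambda>h. e3 h - (- d3 h + h\<^sup>2 *\<^sub>R delta *\<^sub>R G2 h))"
    using absorb_implicit_term[OF _ L3 \<alpha>(2), of "\<lambda>h. - d3 h + h\<^sup>2 *\<^sub>R delta *\<^sub>R G2 h" 4]
    by simp_all
  \<comment> \<open>Up to O(h^5) the stage error is the negative defect, hence - h^4 K2 V.\<close>
  have "is_Oh 5 (\<lambda>h. (e2 h - - d2 h) - (d2 h - (h ^ 4 * K2) *\<^sub>R V))"
    by (intro is_Oh_diff d2 is_Oh_mono[OF e2(3)]) simp
  then have e2': "is_Oh 5 (\<lambda>h. e2 h + (h ^ 4 * K2) *\<^sub>R V)" by (simp add: algebra_simps)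
  have "is_Oh 5 (\<lambda>h. (e3 h - (- d3 h + h\<^sup>2 *\<^sub>R delta *\<^sub>R G2 h)) + h\<^sup>2 *\<^sub>R delta *\<^sub>R G2 h
      - (d3 h - (h ^ 4 * K3) *\<^sub>R V))"
    by (intro is_Oh_diff is_Oh_add d3 is_Oh_mono[OF e3(3)] is_Oh_mono[OF dG2]) simp_all
  then have e3': "is_Oh 5 (\<lambda>h. e3 h + (h ^ 4 * K3) *\<^sub>R V)" by (simp add: algebra_simps)
  \<comment> \<open>One linear map for both stages, so that the weighted combination of the errors
    can be taken inside it.\<close>
  define J where "J = frechet_derivative g (at (y a))"
  have "(g has_derivative J) (at (y a))"
    unfolding J_def using g ya by (intro C_k_on_has_derivative[of 1]) (simp_all add: numeral_2_eq_2)
  then have J: "bounded_linear J" by (rule has_derivative_bounded_linear)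
  then interpret J: bounded_linear J .
  have Y1: "is_Oh 1 (\<lambda>h. Y h 2 - y a)" "is_Oh 1 (\<lambda>h. Y h 3 - y a)"
    using is_Oh_add[OF is_Oh_mono[OF e2(1), of 1] Z1[OF c(1)]] is_Oh_add[OF is_Oh_mono[OF e3(1), of 1] Z1[OF c(2)]]
    by (simp_all add: e2_def e3_def)
  have l: "is_Oh 5 (\<lambda>h. G2 h - J (e2 h))" "is_Oh 5 (\<lambda>h. G3 h - J (e3 h))"
    using linearisation_is_Oh[OF U ya g Y1(1) Z1[OF c(1)], of 4] e2(1)
      linearisation_is_Oh[OF U ya g Y1(2) Z1[OF c(2)], of 4] e3(1)
    by (simp_all add: G2_def G3_def e2_def[abs_def] e3_def[abs_def] J_def)
  have "is_Oh 5 (\<lambda>h. eta *\<^sub>R (e2 h + (h ^ 4 * K2) *\<^sub>R V) + B3 *\<^sub>R (e3 h + (h ^ 4 * K3) *\<^sub>R V))"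
    by (intro is_Oh_add is_Oh_cscaleR e2' e3')
  moreover have "eta *\<^sub>R (e2 h + (h ^ 4 * K2) *\<^sub>R V) + B3 *\<^sub>R (e3 h + (h ^ 4 * K3) *\<^sub>R V)
      = eta *\<^sub>R e2 h + B3 *\<^sub>R e3 h" for h
  proof -
    have "eta *\<^sub>R (e2 h + (h ^ 4 * K2) *\<^sub>R V) + B3 *\<^sub>R (e3 h + (h ^ 4 * K3) *\<^sub>R V)
      = eta *\<^sub>R e2 h + B3 *\<^sub>R e3 h + (h ^ 4 * (eta * K2 + B3 * K3)) *\<^sub>R V"
      by (simp add: algebra_simps)
    then show ?thesis by (simp add: quadrature_conditions)
  qed
  ultimately have e: "is_Oh 5 (\<lambda>h. eta *\<^sub>R e2 h + B3 *\<^sub>R e3 h)" by simp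
  \<comment> \<open>The cancellation holds for the limit \<open>B3\<close>, not for the actual
    weight; the exchange costs only \<open>r h *\<^sub>R G3 h\<close>, of order 8.\<close>
  define r where "r h = b3r (\<omega> * h) - B3" for h
  have r: "is_Oh 4 r" unfolding r_def by (rule is_Oh_compose_scale[OF b3r_expansion \<omega>])
  have "is_Oh (4 + 4) (\<lambda>h. r h *\<^sub>R G3 h)" by (intro is_Oh_scaleR r e3)
  then have rG: "is_Oh 8 (\<lambda>h. r h *\<^sub>R G3 h)" by simp
  have "is_Oh 5 (\<lambda>h. eta *\<^sub>R (G2 h - J (e2 h)) + B3 *\<^sub>R (G3 h - J (e3 h))
      + J (eta *\<^sub>R e2 h + B3 *\<^sub>R e3 h) + r h *\<^sub>R G3 h)"
    by (intro is_Oh_add is_Oh_cscaleR l is_Oh_bounded_linear[OF J] e is_Oh_mono[OF rG]) simp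
  then have "is_Oh 5 (\<lambda>h. eta *\<^sub>R G2 h + b3r (\<omega> * h) *\<^sub>R G3 h)"
    by (simp add: r_def J.add J.scaleR algebra_simps)
  then have "is_Oh (2 + 5) (\<lambda>h. h ^ 2 *\<^sub>R (eta *\<^sub>R G2 h + b3r (\<omega> * h) *\<^sub>R G3 h))"
    by (rule is_Oh_power_scaleR)
  then have "is_Oh 7 (\<lambda>h. R h - h\<^sup>2 *\<^sub>R (eta *\<^sub>R G2 h + b3r (\<omega> * h) *\<^sub>R G3 h))"
    using quadrature_defect by (intro is_Oh_diff) (simp_all add: R_def[abs_def] g_def Z_def)
  then show ?thesis
  proof (rule is_Oh_cong)
    show "\<forall>\<^sub>F h in at_right 0. R h - h\<^sup>2 *\<^sub>R (eta *\<^sub>R G2 h + b3r (\<omega> * h) *\<^sub>R G3 h)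
        = y (a + h) - step ef_method \<omega> f (y a) h (Y h)"
      using eqs
    proof eventually_elim
      case (elim h)
      then have "Y h 1 = y a" by (simp only: stage_eqs_ef_method)
      then show ?case
        by (simp add: step_ef_method R_def G2_def G3_def g_def algebra_simps)
    qed
  qed
qed

end

theorem mainTheorem6:
  fixes \<omega> :: real
  assumes "\<omega> > 0"
  shows "(\<forall>h>0. denominators_nonzero (\<i> * of_real (\<omega> * h)) \<longrightarrow>
            exp_fitted_at ef_method (\<i> * of_real (\<omega> * h))) \<and>
         consistency_order TYPE('a::euclidean_space) ef_method \<omega> 6"
proof (intro conjI allI impI)
  fix h :: real assume "h > 0" "denominators_nonzero (\<i> * of_real (\<omega> * h))"
  then show "exp_fitted_at ef_method (\<i> * of_real (\<omega> * h))"
    using assms by (intro ef_method_exp_fitted) auto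
next
  show "consistency_order TYPE('a) ef_method \<omega> 6"
    unfolding consistency_order_def
  \<comment> \<open>The witness 6: the O(h^7) Taylor remainder uses a continuous seventh derivative
    of y, which is the sixth Lie derivative of \<open>f\<close>.\<close>
  proof (rule exI[of _ 6], intro allI impI conjI; elim conjE)
    fix U :: "'a set" and f y and x T :: real
    assume *: "open U" "C_k_on 6 f U" "T > 0" "\<forall>t\<in>{x..x + T}. y t \<in> U \<and>
      (y has_vector_derivative f (y t)) (at t within {x..x + T})"
    show "\<exists>Y. stage_branch ef_method \<omega> f (y x) Y"
      by (rule stage_branch_exists[OF *(1-3) assms, of x]) (use *(4) in auto)
    fix Y assume Y: "stage_branch ef_method \<omega> f (y x) Y"
    have "is_Oh 7 (\<lambda>h. y (x + h) - step ef_method \<omega> f (y x) h (Y h))"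
      by (rule stage_branch_error[where y = y and f = f and a = x, OF *(1-3) assms _ _ Y]) (use *(4) in auto)
    then show "(\<lambda>h. norm (y (x + h) - step ef_method \<omega> f (y x) h (Y h)))
        \<in> O[at_right 0](\<lambda>h. h ^ (6 + 1))"
      using is_Oh_imp_bigo by simp
  qed
qed

end
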